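(* Let $(A,\rhd_A,\lhd_A,\delta_{\rhd},\delta_{\lhd})$ be a bi-dialgebra and $(\mathfrak{D},\rhd_{\mathfrak{D}},\lhd_{\mathfrak{D}})$ be its Drinfeld classical double. Let $\{e_1,\ldots,e_n\}$ be a basis of $A$ and $\{e_1^*,\ldots,e_n^*\}$ be the dual basis. Set $$r=\sum_{i=1}^n e_i\otimes e_i^*\in A\otimes A^*\subset\mathfrak{D}\otimes\mathfrak{D}.$$ Then $(\mathfrak{D},\rhd_{\mathfrak{D}},\lhd_{\mathfrak{D}},\delta_{\rhd,r},\delta_{\lhd,r})$ is a factorizable bi-dialgebra, where $\delta_{\rhd,r},\delta_{\lhd,r}:\mathfrak{D}\to\mathfrak{D}\otimes\mathfrak{D}$ are given by $\delta_{\rhd,r}(u)=(R_{\star}(u)\otimes\mathrm{id}+\mathrm{id}\otimes L_{\lhd}(u))r$ and $\delta_{\lhd,r}(u)=(R_{\rhd}(u)\otimes\mathrm{id}-\mathrm{id}\otimes L_{\star}(u))r$ for $u\in\mathfrak{D}$, with the operators taken with respect to $\rhd_{\mathfrak{D}},\lhd_{\mathfrak{D}}$.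
   Context: All vector spaces and algebras are finite-dimensional over a field $\mathbb F$ of characteristic $0$; algebras are not assumed unital. **Dialgebra.** $(A,\rhd,\lhd)$ where $\rhd,\lhd$ are associative bilinear products with $(x\lhd y)\lhd z=x\lhd(y\rhd z)$, $(x\rhd y)\lhd z=x\rhd(y\lhd z)$, $(x\lhd y)\rhd z=x\rhd(y\rhd z)$. **Notation.** $x\star y=x\rhd y-x\lhd y$; $L_\diamond(x)y=x\diamond y=R_\diamond(y)x$; $\tau(x\otimes y)=y\otimes x$. For linear $\varphi:A\to\mathrm{End}(V)$, $\varphi^*:A\to\mathrm{End}(V^* )$ is given by $\langle\varphi^*(x)v^*,u\rangle=-\langle v^*,\varphi(x)u\rangle$. **Co-dialgebra.** $(A,\delta_{\rhd},\delta_{\lhd})$ with $\delta_{\rhd},\delta_{\lhd}:A\to A\otimes A$ linear and coassociative with $(\mathrm{id}\otimes\delta_{\lhd})\delta_{\lhd}=(\mathrm{id}\otimes\delta_{\rhd})\delta_{\lhd}$, $(\delta_{\rhd}\otimes\mathrm{id})\delta_{\lhd}=(\mathrm{id}\otimes\delta_{\lhd})\delta_{\rhd}$, $(\delta_{\lhd}\otimes\mathrm{id})\delta_{\rhd}=(\delta_{\rhd}\otimes\mathrm{id})\delta_{\rhd}$. **Bi-dialgebra.** $(A,\rhd,\lhd,\delta_{\rhd},\delta_{\lhd})$, a dialgebra and a co-dialgebra such that, with $\delta_\star=\delta_{\rhd}-\delta_{\lhd}$, for all $x,y\in A$: $(\mathrm{id}\otimes L_{\lhd}(x))\delta_{\lhd}(y)=(R_{\rhd}(y)\otimes\mathrm{id})\delta_{\rhd}(x)$;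 $(L_{\lhd}(x)\otimes\mathrm{id})\delta_{\rhd}(y)=(\mathrm{id}\otimes L_{\lhd}(y))\tau\delta_{\rhd}(x)$; $(R_{\rhd}(x)\otimes\mathrm{id})\tau\delta_{\lhd}(y)=(\mathrm{id}\otimes R_{\rhd}(y))\delta_{\lhd}(x)$; $\delta_{\rhd}(x\rhd y)=(\mathrm{id}\otimes L_{\rhd}(x))\delta_{\rhd}(y)-(R_{\star}(y)\otimes\mathrm{id})\delta_{\star}(x)$; $\delta_{\rhd}(x\lhd y)=(\mathrm{id}\otimes L_{\lhd}(x))\delta_{\star}(y)+(R_{\lhd}(y)\otimes\mathrm{id})\delta_{\rhd}(x)$; $\delta_{\lhd}(x\rhd y)=(\mathrm{id}\otimes L_{\star}(x))\delta_{\lhd}(y)+(R_{\rhd}(y)\otimes\mathrm{id})\delta_{\lhd}(x)$; $\delta_{\lhd}(x\lhd y)=(R_{\lhd}(y)\otimes\mathrm{id})\delta_{\lhd}(x)-(\mathrm{id}\otimes L_{\star}(x))\delta_{\star}(y)$; $(L_{\star}(x)\otimes\mathrm{id})\delta_{\rhd}(y)+(\mathrm{id}\otimes L_{\lhd}(y))\tau\delta_{\lhd}(x)=(R_{\star}(y)\otimes\mathrm{id})\tau\delta_{\star}(x)+(\mathrm{id}\otimes R_{\lhd}(x))\delta_{\rhd}(y)$; $(R_{\lhd}(x)\otimes\mathrm{id})\tau\delta_{\lhd}(y)+(\mathrm{id}\otimes R_{\rhd}(y))\delta_{\star}(x)=(L_{\star}(y)\otimes\mathrm{id})\delta_{\star}(x)+(\mathrm{id}\otimes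 L_{\rhd}(x))\tau\delta_{\lhd}(y)$. **Drinfeld classical double.** Let $\rhd_{A^*},\lhd_{A^*}$ be the linear duals of $\delta_{\rhd},\delta_{\lhd}$: $\langle a^*\rhd_{A^*}b^*,x\rangle=\langle a^*\otimes b^*,\delta_{\rhd}(x)\rangle$, and similarly for $\lhd$; $\mathcal L_\diamond,\mathcal R_\diamond$ denote the left and right multiplications on $A^*$ ($\diamond\in\{\rhd,\lhd,\star\}$, $a^*\star b^*=a^*\rhd_{A^*}b^*-a^*\lhd_{A^*}b^*$), and their duals act on $A^{**}=A$ with the same sign convention. The Drinfeld classical double is $\mathfrak D=A\oplus A^*$ with the dialgebra structure $(x+a^* )\rhd_{\mathfrak D}(y+b^* )=x\rhd_A y-\mathcal R_{\lhd}^*(a^* )y-\mathcal L_{\star}^*(b^* )x-R_{\lhd}^*(x)b^*-L_{\star}^*(y)a^*+a^*\rhd_{A^*}b^*$, $(x+a^* )\lhd_{\mathfrak D}(y+b^* )=x\lhd_A y+\mathcal R_{\star}^*(a^* )y-\mathcal L_{\rhd}^*(b^* )x+R_{\star}^*(x)b^*-L_{\rhd}^*(y)a^*+a^*\lhd_{A^*}b^*$. **Factorizable.** For a dialgebra $D$ and $r=\sum_i a_i\otimes b_i\in D\otimes D$: $r$ solves the diassociative Yang-Baxter equation (DAYBE) if $\sum_{i,j}\big(a_i\otimes a_j\otimes b_i\rhd b_j-a_j\otimes a_i\lhd b_j\otimes b_i-a_i\star a_j\otimes b_i\otimes b_j\big)=0$; $s\in D\otimes D$ is invariant if $(R_{\star}(u)\otimes\mathrm{id}+\mathrm{id}\otimes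 L_{\lhd}(u))s=0=(R_{\rhd}(u)\otimes\mathrm{id}-\mathrm{id}\otimes L_{\star}(u))s$ for all $u\in D$. If $r$ solves the DAYBE and its skew-symmetric part $\alpha=r-\tau(r)$ is invariant, the bi-dialgebra $(D,\rhd,\lhd,\delta_{\rhd,r},\delta_{\lhd,r})$ is called quasi-triangular; it is called factorizable if in addition $\widetilde\alpha:D^*\to D$, $\langle\widetilde\alpha(u^* ),v^*\rangle=\langle\alpha,u^*\otimes v^*\rangle$, is a linear isomorphism. *)

theory Defs
  imports Complex_Main "HOL-Library.Function_Algebras" "HOL-Library.Product_Plus"
begin

text \<open>
  A vector space over the field \<open>'f\<close> is a subspace \<open>V\<close> of an ambient type \<open>'v\<close> that carries
  a scalar multiplication \<open>s\<close>.  Carrier sets are needed because the dual space and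
  \<open>A \<oplus> A\<^sup>*\<close> are proper subsets of the types \<open>'v \<Rightarrow> 'f\<close> and \<open>'a \<times> ('a \<Rightarrow> 'f)\<close>.
  Addition on these types is the pointwise and the componentwise one.
\<close>

definition fd_vector_space :: "('f::field \<Rightarrow> 'v::ab_group_add \<Rightarrow> 'v) \<Rightarrow> 'v set \<Rightarrow> bool" where
  "fd_vector_space s V \<longleftrightarrow> vector_space s \<and> module.subspace s V \<and>
     (\<exists>B. finite B \<and> B \<subseteq> V \<and> module.span s B = V)"

definition linear_on ::
  "('f \<Rightarrow> 'v::ab_group_add \<Rightarrow> 'v) \<Rightarrow> ('f \<Rightarrow> 'w::ab_group_add \<Rightarrow> 'w) \<Rightarrow> 'v set \<Rightarrow> ('v \<Rightarrow> 'w) \<Rightarrow> bool" where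
  "linear_on s s' V f \<longleftrightarrow>
     (\<forall>x\<in>V. \<forall>y\<in>V. f (x + y) = f x + f y) \<and> (\<forall>c. \<forall>x\<in>V. f (s c x) = s' c (f x))"

text \<open>
  A function on \<open>X\<close> is represented by its extension by zero, so that equality of functions
  on \<open>X\<close> is equality in HOL and sums and multiples of such functions are again of this form.
\<close>

definition ext0 :: "'x set \<Rightarrow> ('x \<Rightarrow> 'y::zero) \<Rightarrow> 'x \<Rightarrow> 'y" where
  "ext0 X f = (\<lambda>x. if x \<in> X then f x else 0)"

definition fscale :: "'f::times \<Rightarrow> ('x \<Rightarrow> 'f) \<Rightarrow> 'x \<Rightarrow> 'f" where
  "fscale c f = (\<lambda>x. c * f x)"

definition dual :: "('f::field \<Rightarrow> 'v::ab_group_add \<Rightarrow> 'v) \<Rightarrow> 'v set \<Rightarrow> ('v \<Rightarrow> 'f) set" where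
  "dual s V = {\<phi>. linear_on s (*) V \<phi> \<and> (\<forall>x. x \<notin> V \<longrightarrow> \<phi> x = 0)}"

text \<open>The canonical map \<open>V \<rightarrow> V\<^sup>*\<^sup>*\<close> and, for finite-dimensional \<open>V\<close>, its inverse.\<close>

definition ev :: "('f::field \<Rightarrow> 'v::ab_group_add \<Rightarrow> 'v) \<Rightarrow> 'v set \<Rightarrow> 'v \<Rightarrow> ('v \<Rightarrow> 'f) \<Rightarrow> 'f" where
  "ev s V x = ext0 (dual s V) (\<lambda>\<phi>. \<phi> x)"

definition un_ev :: "('f::field \<Rightarrow> 'v::ab_group_add \<Rightarrow> 'v) \<Rightarrow> 'v set \<Rightarrow> (('v \<Rightarrow> 'f) \<Rightarrow> 'f) \<Rightarrow> 'v" where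
  "un_ev s V \<Phi> = (THE x. x \<in> V \<and> ev s V x = \<Phi>)"


section \<open>Tensors\<close>

text \<open>
  For finite-dimensional \<open>V\<close>, the space \<open>V \<otimes> V\<close> is the space of bilinear forms on
  \<open>V\<^sup>* \<times> V\<^sup>*\<close>: the tensor \<open>t\<close> is the form \<open>(u, v) \<mapsto> \<langle>u \<otimes> v, t\<rangle>\<close>, and \<open>x \<otimes> y\<close> is
  \<open>(u, v) \<mapsto> u x * v y\<close>.  Similarly \<open>V \<otimes> V \<otimes> V\<close> consists of trilinear forms.
\<close>

type_synonym ('v, 'f) tensor2 = "('v \<Rightarrow> 'f) \<times> ('v \<Rightarrow> 'f) \<Rightarrow> 'f"
type_synonym ('v, 'f) tensor3 = "('v \<Rightarrow> 'f) \<times> ('v \<Rightarrow> 'f) \<times> ('v \<Rightarrow> 'f) \<Rightarrow> 'f"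

definition tensor2 ::
  "('f::field \<Rightarrow> 'v::ab_group_add \<Rightarrow> 'v) \<Rightarrow> 'v set \<Rightarrow> ('v, 'f) tensor2 set" where
  "tensor2 s V = {t.
     (\<forall>v\<in>dual s V. linear_on fscale (*) (dual s V) (\<lambda>u. t (u, v))) \<and>
     (\<forall>u\<in>dual s V. linear_on fscale (*) (dual s V) (\<lambda>v. t (u, v))) \<and>
     (\<forall>p. p \<notin> dual s V \<times> dual s V \<longrightarrow> t p = 0)}"

definition tens ::
  "('f::field \<Rightarrow> 'v::ab_group_add \<Rightarrow> 'v) \<Rightarrow> 'v set \<Rightarrow> 'v \<Rightarrow> 'v \<Rightarrow> ('v, 'f) tensor2" where
  "tens s V x y = ext0 (dual s V \<times> dual s V) (\<lambda>(u, v). u x * v y)"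

definition tens3 ::
  "('f::field \<Rightarrow> 'v::ab_group_add \<Rightarrow> 'v) \<Rightarrow> 'v set \<Rightarrow> 'v \<Rightarrow> 'v \<Rightarrow> 'v \<Rightarrow> ('v, 'f) tensor3" where
  "tens3 s V x y z = ext0 (dual s V \<times> dual s V \<times> dual s V) (\<lambda>(u, v, w). u x * v y * w z)"

text \<open>
  \<open>tmap s V f g\<close> is \<open>f \<otimes> g\<close> for endomorphisms \<open>f\<close> and \<open>g\<close> of \<open>V\<close>, expressed through
  \<open>\<langle>u \<otimes> v, (f \<otimes> g) t\<rangle> = \<langle>(u \<circ> f) \<otimes> (v \<circ> g), t\<rangle>\<close>; \<open>cotens1\<close> and \<open>cotens2\<close> are
  \<open>\<delta> \<otimes> id\<close> and \<open>id \<otimes> \<delta>\<close> for \<open>\<delta> : V \<rightarrow> V \<otimes> V\<close>.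
\<close>

definition tmap ::
  "('f::field \<Rightarrow> 'v::ab_group_add \<Rightarrow> 'v) \<Rightarrow> 'v set \<Rightarrow> ('v \<Rightarrow> 'v) \<Rightarrow> ('v \<Rightarrow> 'v) \<Rightarrow>
     ('v, 'f) tensor2 \<Rightarrow> ('v, 'f) tensor2" where
  "tmap s V f g t = ext0 (dual s V \<times> dual s V)
     (\<lambda>(u, v). t (ext0 V (\<lambda>x. u (f x)), ext0 V (\<lambda>y. v (g y))))"

definition tau :: "('v, 'f) tensor2 \<Rightarrow> ('v, 'f) tensor2" where
  "tau t = (\<lambda>(u, v). t (v, u))"

definition cotens1 ::
  "('f::field \<Rightarrow> 'v::ab_group_add \<Rightarrow> 'v) \<Rightarrow> 'v set \<Rightarrow> ('v \<Rightarrow> ('v, 'f) tensor2) \<Rightarrow>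
     ('v, 'f) tensor2 \<Rightarrow> ('v, 'f) tensor3" where
  "cotens1 s V \<delta> t = ext0 (dual s V \<times> dual s V \<times> dual s V)
     (\<lambda>(u, v, w). t (ext0 V (\<lambda>x. \<delta> x (u, v)), w))"

definition cotens2 ::
  "('f::field \<Rightarrow> 'v::ab_group_add \<Rightarrow> 'v) \<Rightarrow> 'v set \<Rightarrow> ('v \<Rightarrow> ('v, 'f) tensor2) \<Rightarrow>
     ('v, 'f) tensor2 \<Rightarrow> ('v, 'f) tensor3" where
  "cotens2 s V \<delta> t = ext0 (dual s V \<times> dual s V \<times> dual s V)
     (\<lambda>(u, v, w). t (u, ext0 V (\<lambda>x. \<delta> x (v, w))))"


section \<open>Dialgebras, co-dialgebras and bi-dialgebras\<close>

text \<open>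
  Throughout, \<open>rh\<close> and \<open>lh\<close> are the products \<open>\<rhd>\<close> and \<open>\<lhd>\<close>, and \<open>dr\<close> and \<open>dl\<close> the
  coproducts \<open>\<delta>\<^sub>\<rhd>\<close> and \<open>\<delta>\<^sub>\<lhd>\<close>.
\<close>

definition star :: "('v \<Rightarrow> 'v \<Rightarrow> 'v::ab_group_add) \<Rightarrow> ('v \<Rightarrow> 'v \<Rightarrow> 'v) \<Rightarrow> 'v \<Rightarrow> 'v \<Rightarrow> 'v" where
  "star rh lh x y = rh x y - lh x y"

definition lmul :: "('v \<Rightarrow> 'v \<Rightarrow> 'v) \<Rightarrow> 'v \<Rightarrow> 'v \<Rightarrow> 'v" where
  "lmul m x = (\<lambda>y. m x y)"

definition rmul :: "('v \<Rightarrow> 'v \<Rightarrow> 'v) \<Rightarrow> 'v \<Rightarrow> 'v \<Rightarrow> 'v" where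
  "rmul m y = (\<lambda>x. m x y)"

definition bilinear_product ::
  "('f::field \<Rightarrow> 'v::ab_group_add \<Rightarrow> 'v) \<Rightarrow> 'v set \<Rightarrow> ('v \<Rightarrow> 'v \<Rightarrow> 'v) \<Rightarrow> bool" where
  "bilinear_product s V m \<longleftrightarrow>
     (\<forall>x\<in>V. \<forall>y\<in>V. m x y \<in> V) \<and>
     (\<forall>x\<in>V. linear_on s s V (lmul m x)) \<and> (\<forall>y\<in>V. linear_on s s V (rmul m y))"

definition dialgebra ::
  "('f::field \<Rightarrow> 'v::ab_group_add \<Rightarrow> 'v) \<Rightarrow> 'v set \<Rightarrow> ('v \<Rightarrow> 'v \<Rightarrow> 'v) \<Rightarrow> ('v \<Rightarrow> 'v \<Rightarrow> 'v) \<Rightarrow> bool" where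
  "dialgebra s V rh lh \<longleftrightarrow>
     fd_vector_space s V \<and> bilinear_product s V rh \<and> bilinear_product s V lh \<and>
     (\<forall>x\<in>V. \<forall>y\<in>V. \<forall>z\<in>V.
        rh (rh x y) z = rh x (rh y z) \<and>
        lh (lh x y) z = lh x (lh y z) \<and>
        lh (lh x y) z = lh x (rh y z) \<and>
        lh (rh x y) z = rh x (lh y z) \<and>
        rh (lh x y) z = rh x (rh y z))"

definition coproduct ::
  "('f::field \<Rightarrow> 'v::ab_group_add \<Rightarrow> 'v) \<Rightarrow> 'v set \<Rightarrow> ('v \<Rightarrow> ('v, 'f) tensor2) \<Rightarrow> bool" where
  "coproduct s V \<delta> \<longleftrightarrow> (\<forall>x\<in>V. \<delta> x \<in> tensor2 s V) \<and> linear_on s fscale V \<delta>"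

definition codialgebra ::
  "('f::field \<Rightarrow> 'v::ab_group_add \<Rightarrow> 'v) \<Rightarrow> 'v set \<Rightarrow>
     ('v \<Rightarrow> ('v, 'f) tensor2) \<Rightarrow> ('v \<Rightarrow> ('v, 'f) tensor2) \<Rightarrow> bool" where
  "codialgebra s V dr dl \<longleftrightarrow>
     fd_vector_space s V \<and> coproduct s V dr \<and> coproduct s V dl \<and>
     (\<forall>x\<in>V.
        cotens1 s V dr (dr x) = cotens2 s V dr (dr x) \<and>
        cotens1 s V dl (dl x) = cotens2 s V dl (dl x) \<and>
        cotens2 s V dl (dl x) = cotens2 s V dr (dl x) \<and>
        cotens1 s V dr (dl x) = cotens2 s V dl (dr x) \<and>
        cotens1 s V dl (dr x) = cotens1 s V dr (dr x))"

definition bi_dialgebra ::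
  "('f::field \<Rightarrow> 'v::ab_group_add \<Rightarrow> 'v) \<Rightarrow> 'v set \<Rightarrow> ('v \<Rightarrow> 'v \<Rightarrow> 'v) \<Rightarrow> ('v \<Rightarrow> 'v \<Rightarrow> 'v) \<Rightarrow>
     ('v \<Rightarrow> ('v, 'f) tensor2) \<Rightarrow> ('v \<Rightarrow> ('v, 'f) tensor2) \<Rightarrow> bool" where
  "bi_dialgebra s V rh lh dr dl \<longleftrightarrow>
     dialgebra s V rh lh \<and> codialgebra s V dr dl \<and>
     (let st = star rh lh; ds = (\<lambda>x. dr x - dl x) in
      \<forall>x\<in>V. \<forall>y\<in>V.
        tmap s V id (lmul lh x) (dl y) = tmap s V (rmul rh y) id (dr x) \<and>
        tmap s V (lmul lh x) id (dr y) = tmap s V id (lmul lh y) (tau (dr x)) \<and>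
        tmap s V (rmul rh x) id (tau (dl y)) = tmap s V id (rmul rh y) (dl x) \<and>
        dr (rh x y) = tmap s V id (lmul rh x) (dr y) - tmap s V (rmul st y) id (ds x) \<and>
        dr (lh x y) = tmap s V id (lmul lh x) (ds y) + tmap s V (rmul lh y) id (dr x) \<and>
        dl (rh x y) = tmap s V id (lmul st x) (dl y) + tmap s V (rmul rh y) id (dl x) \<and>
        dl (lh x y) = tmap s V (rmul lh y) id (dl x) - tmap s V id (lmul st x) (ds y) \<and>
        tmap s V (lmul st x) id (dr y) + tmap s V id (lmul lh y) (tau (dl x)) =
          tmap s V (rmul st y) id (tau (ds x)) + tmap s V id (rmul lh x) (dr y) \<and>
        tmap s V (rmul lh x) id (tau (dl y)) + tmap s V id (rmul rh y) (ds x) =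
          tmap s V (lmul st y) id (ds x) + tmap s V id (lmul rh x) (tau (dl y)))"


section \<open>The Drinfeld classical double\<close>

text \<open>The product on \<open>V\<^sup>*\<close> dual to \<open>\<delta>\<close>; note that \<open>\<langle>a \<otimes> b, \<delta> x\<rangle>\<close> is \<open>\<delta> x (a, b)\<close>.\<close>

definition dual_mult ::
  "'v set \<Rightarrow> ('v \<Rightarrow> ('v, 'f::field) tensor2) \<Rightarrow> ('v \<Rightarrow> 'f) \<Rightarrow> ('v \<Rightarrow> 'f) \<Rightarrow> ('v \<Rightarrow> 'f)" where
  "dual_mult V \<delta> a b = ext0 V (\<lambda>x. \<delta> x (a, b))"

text \<open>\<open>contra V (\<phi> x)\<close> is the operator \<open>\<phi>\<^sup>*(x)\<close> on \<open>V\<^sup>*\<close>.\<close>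

definition contra :: "'v set \<Rightarrow> ('v \<Rightarrow> 'v) \<Rightarrow> ('v \<Rightarrow> 'f::field) \<Rightarrow> ('v \<Rightarrow> 'f)" where
  "contra V f v = ext0 V (\<lambda>u. - v (f u))"

text \<open>The same for an operator on \<open>V\<^sup>*\<close>, transported along \<open>V\<^sup>*\<^sup>* = V\<close>.\<close>

definition contra_dual ::
  "('f::field \<Rightarrow> 'v::ab_group_add \<Rightarrow> 'v) \<Rightarrow> 'v set \<Rightarrow> (('v \<Rightarrow> 'f) \<Rightarrow> ('v \<Rightarrow> 'f)) \<Rightarrow> 'v \<Rightarrow> 'v" where
  "contra_dual s V f x = un_ev s V (contra (dual s V) f (ev s V x))"

definition double_carrier ::
  "('f::field \<Rightarrow> 'a::ab_group_add \<Rightarrow> 'a) \<Rightarrow> 'a set \<Rightarrow> ('a \<times> ('a \<Rightarrow> 'f)) set" where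
  "double_carrier s A = A \<times> dual s A"

definition double_scale ::
  "('f::field \<Rightarrow> 'a::ab_group_add \<Rightarrow> 'a) \<Rightarrow> 'f \<Rightarrow> 'a \<times> ('a \<Rightarrow> 'f) \<Rightarrow> 'a \<times> ('a \<Rightarrow> 'f)" where
  "double_scale s c = (\<lambda>(x, a). (s c x, fscale c a))"

definition double_rh ::
  "('f::field \<Rightarrow> 'a::ab_group_add \<Rightarrow> 'a) \<Rightarrow> 'a set \<Rightarrow> ('a \<Rightarrow> 'a \<Rightarrow> 'a) \<Rightarrow> ('a \<Rightarrow> 'a \<Rightarrow> 'a) \<Rightarrow>
     ('a \<Rightarrow> ('a, 'f) tensor2) \<Rightarrow> ('a \<Rightarrow> ('a, 'f) tensor2) \<Rightarrow>
     'a \<times> ('a \<Rightarrow> 'f) \<Rightarrow> 'a \<times> ('a \<Rightarrow> 'f) \<Rightarrow> 'a \<times> ('a \<Rightarrow> 'f)" where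
  "double_rh s A rh lh dr dl = (\<lambda>(x, a) (y, b).
     let rh' = dual_mult A dr; lh' = dual_mult A dl in
     (rh x y - contra_dual s A (rmul lh' a) y - contra_dual s A (lmul (star rh' lh') b) x,
      - contra A (rmul lh x) b - contra A (lmul (star rh lh) y) a + rh' a b))"

definition double_lh ::
  "('f::field \<Rightarrow> 'a::ab_group_add \<Rightarrow> 'a) \<Rightarrow> 'a set \<Rightarrow> ('a \<Rightarrow> 'a \<Rightarrow> 'a) \<Rightarrow> ('a \<Rightarrow> 'a \<Rightarrow> 'a) \<Rightarrow>
     ('a \<Rightarrow> ('a, 'f) tensor2) \<Rightarrow> ('a \<Rightarrow> ('a, 'f) tensor2) \<Rightarrow>
     'a \<times> ('a \<Rightarrow> 'f) \<Rightarrow> 'a \<times> ('a \<Rightarrow> 'f) \<Rightarrow> 'a \<times> ('a \<Rightarrow> 'f)" where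
  "double_lh s A rh lh dr dl = (\<lambda>(x, a) (y, b).
     let rh' = dual_mult A dr; lh' = dual_mult A dl in
     (lh x y + contra_dual s A (rmul (star rh' lh') a) y - contra_dual s A (lmul rh' b) x,
      contra A (rmul (star rh lh) x) b - contra A (lmul rh y) a + lh' a b))"


section \<open>Factorizable bi-dialgebras\<close>

text \<open>The choice of the decomposition of \<open>r\<close> is irrelevant, see \<open>daybe_independent\<close> below.\<close>

definition daybe_sum ::
  "('f::field \<Rightarrow> 'v::ab_group_add \<Rightarrow> 'v) \<Rightarrow> 'v set \<Rightarrow> ('v \<Rightarrow> 'v \<Rightarrow> 'v) \<Rightarrow> ('v \<Rightarrow> 'v \<Rightarrow> 'v) \<Rightarrow>
     nat \<Rightarrow> (nat \<Rightarrow> 'v) \<Rightarrow> (nat \<Rightarrow> 'v) \<Rightarrow> ('v, 'f) tensor3" where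
  "daybe_sum s V rh lh n a b = (\<Sum>i<n. \<Sum>j<n.
     tens3 s V (a i) (a j) (rh (b i) (b j)) - tens3 s V (a j) (lh (a i) (b j)) (b i)
       - tens3 s V (star rh lh (a i) (a j)) (b i) (b j))"

definition daybe ::
  "('f::field \<Rightarrow> 'v::ab_group_add \<Rightarrow> 'v) \<Rightarrow> 'v set \<Rightarrow> ('v \<Rightarrow> 'v \<Rightarrow> 'v) \<Rightarrow> ('v \<Rightarrow> 'v \<Rightarrow> 'v) \<Rightarrow>
     ('v, 'f) tensor2 \<Rightarrow> bool" where
  "daybe s V rh lh r \<longleftrightarrow> (\<exists>n a b.
     (\<forall>i<n. a i \<in> V \<and> b i \<in> V) \<and> r = (\<Sum>i<n. tens s V (a i) (b i)) \<and>
     daybe_sum s V rh lh n a b = 0)"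

definition delta_rh ::
  "('f::field \<Rightarrow> 'v::ab_group_add \<Rightarrow> 'v) \<Rightarrow> 'v set \<Rightarrow> ('v \<Rightarrow> 'v \<Rightarrow> 'v) \<Rightarrow> ('v \<Rightarrow> 'v \<Rightarrow> 'v) \<Rightarrow>
     ('v, 'f) tensor2 \<Rightarrow> 'v \<Rightarrow> ('v, 'f) tensor2" where
  "delta_rh s V rh lh r u = tmap s V (rmul (star rh lh) u) id r + tmap s V id (lmul lh u) r"

definition delta_lh ::
  "('f::field \<Rightarrow> 'v::ab_group_add \<Rightarrow> 'v) \<Rightarrow> 'v set \<Rightarrow> ('v \<Rightarrow> 'v \<Rightarrow> 'v) \<Rightarrow> ('v \<Rightarrow> 'v \<Rightarrow> 'v) \<Rightarrow>
     ('v, 'f) tensor2 \<Rightarrow> 'v \<Rightarrow> ('v, 'f) tensor2" where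
  "delta_lh s V rh lh r u = tmap s V (rmul rh u) id r - tmap s V id (lmul (star rh lh) u) r"

definition invariant_tensor ::
  "('f::field \<Rightarrow> 'v::ab_group_add \<Rightarrow> 'v) \<Rightarrow> 'v set \<Rightarrow> ('v \<Rightarrow> 'v \<Rightarrow> 'v) \<Rightarrow> ('v \<Rightarrow> 'v \<Rightarrow> 'v) \<Rightarrow>
     ('v, 'f) tensor2 \<Rightarrow> bool" where
  "invariant_tensor s V rh lh t \<longleftrightarrow>
     (\<forall>u\<in>V. tmap s V (rmul (star rh lh) u) id t + tmap s V id (lmul lh u) t = 0 \<and>
            tmap s V (rmul rh u) id t - tmap s V id (lmul (star rh lh) u) t = 0)"

text \<open>
  The coproducts of a quasi-triangular or factorizable bi-dialgebra are determined by \<open>r\<close>: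
  they are \<open>delta_rh s V rh lh r\<close> and \<open>delta_lh s V rh lh r\<close>.
\<close>

definition quasi_triangular ::
  "('f::field \<Rightarrow> 'v::ab_group_add \<Rightarrow> 'v) \<Rightarrow> 'v set \<Rightarrow> ('v \<Rightarrow> 'v \<Rightarrow> 'v) \<Rightarrow> ('v \<Rightarrow> 'v \<Rightarrow> 'v) \<Rightarrow>
     ('v, 'f) tensor2 \<Rightarrow> bool" where
  "quasi_triangular s V rh lh r \<longleftrightarrow>
     bi_dialgebra s V rh lh (delta_rh s V rh lh r) (delta_lh s V rh lh r) \<and>
     r \<in> tensor2 s V \<and> daybe s V rh lh r \<and> invariant_tensor s V rh lh (r - tau r)"

text \<open>For \<open>t \<in> V \<otimes> V\<close>, the map \<open>V\<^sup>* \<rightarrow> V\<close> with \<open>\<langle>sharp t u, v\<rangle> = \<langle>t, u \<otimes> v\<rangle>\<close>.\<close>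

definition sharp ::
  "('f::field \<Rightarrow> 'v::ab_group_add \<Rightarrow> 'v) \<Rightarrow> 'v set \<Rightarrow> ('v, 'f) tensor2 \<Rightarrow> ('v \<Rightarrow> 'f) \<Rightarrow> 'v" where
  "sharp s V t u = (THE x. x \<in> V \<and> (\<forall>v\<in>dual s V. v x = t (u, v)))"

definition factorizable ::
  "('f::field \<Rightarrow> 'v::ab_group_add \<Rightarrow> 'v) \<Rightarrow> 'v set \<Rightarrow> ('v \<Rightarrow> 'v \<Rightarrow> 'v) \<Rightarrow> ('v \<Rightarrow> 'v \<Rightarrow> 'v) \<Rightarrow>
     ('v, 'f) tensor2 \<Rightarrow> bool" where
  "factorizable s V rh lh r \<longleftrightarrow>
     quasi_triangular s V rh lh r \<and>
     linear_on fscale s (dual s V) (sharp s V (r - tau r)) \<and>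
     bij_betw (sharp s V (r - tau r)) (dual s V) V"


section \<open>Consistency of the tensor model\<close>

lemma dual_pull:
  assumes "u \<in> dual s V" "linear_on s s V f" "\<And>x. x \<in> V \<Longrightarrow> f x \<in> V"
    and "\<And>x y. x \<in> V \<Longrightarrow> y \<in> V \<Longrightarrow> x + y \<in> V" "\<And>c x. x \<in> V \<Longrightarrow> s c x \<in> V"
  shows "ext0 V (\<lambda>x. u (f x)) \<in> dual s V"
  using assms by (auto simp: dual_def linear_on_def ext0_def)

lemma subspace_closed:
  assumes "fd_vector_space s V"
  shows "x \<in> V \<Longrightarrow> y \<in> V \<Longrightarrow> x + y \<in> V" "x \<in> V \<Longrightarrow> s c x \<in> V" "0 \<in> V"
proof -
  interpret vector_space s using assms by (simp add: fd_vector_space_def)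
  have "subspace V" using assms by (simp add: fd_vector_space_def)
  then show "x \<in> V \<Longrightarrow> y \<in> V \<Longrightarrow> x + y \<in> V" "x \<in> V \<Longrightarrow> s c x \<in> V" "0 \<in> V"
    by (auto simp: subspace_def)
qed

lemma tens_in_tensor2:
  assumes "x \<in> V" "y \<in> V"
  shows "tens s V x y \<in> tensor2 s V"
  using assms
  by (auto simp: tensor2_def tens_def ext0_def linear_on_def fscale_def dual_def algebra_simps)

lemma tmap_tens:
  assumes "fd_vector_space s V" "x \<in> V" "y \<in> V"
    and "linear_on s s V f" "\<And>x. x \<in> V \<Longrightarrow> f x \<in> V"
    and "linear_on s s V g" "\<And>x. x \<in> V \<Longrightarrow> g x \<in> V"
  shows "tmap s V f g (tens s V x y) = tens s V (f x) (g y)"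
  using dual_pull[OF _ assms(4,5) subspace_closed(1,2)[OF assms(1)]]
    dual_pull[OF _ assms(6,7) subspace_closed(1,2)[OF assms(1)]] assms(2,3)
  by (auto simp: tmap_def tens_def ext0_def fun_eq_iff)

lemma tau_tens: "tau (tens s V x y) = tens s V y x"
  by (auto simp: tau_def tens_def ext0_def fun_eq_iff)

lemma sum_apply: "(\<Sum>i\<in>I. f i) x = (\<Sum>i\<in>I. f i x)"
  by (induction I rule: infinite_finite_induct) auto

lemma linear_on_sum:
  assumes "linear_on s s' V f" "f 0 = 0" "0 \<in> V"
    and "\<And>x y. x \<in> V \<Longrightarrow> y \<in> V \<Longrightarrow> x + y \<in> V" "\<And>c x. x \<in> V \<Longrightarrow> s c x \<in> V"
    and "\<And>i. i \<in> I \<Longrightarrow> x i \<in> V"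
  shows "f (\<Sum>i\<in>I. s (c i) (x i)) = (\<Sum>i\<in>I. s' (c i) (f (x i))) \<and> (\<Sum>i\<in>I. s (c i) (x i)) \<in> V"
  using assms(6)
proof (induction I rule: infinite_finite_induct)
  case (insert i I)
  then show ?case
    using assms(1,4,5) by (auto simp: linear_on_def)
qed (simp_all add: assms(2,3))

lemma dual_closed:
  shows "u \<in> dual s V \<Longrightarrow> v \<in> dual s V \<Longrightarrow> u + v \<in> dual s V"
    and "u \<in> dual s V \<Longrightarrow> fscale c u \<in> dual s V"
    and "0 \<in> dual s V"
  by (auto simp: dual_def linear_on_def fscale_def algebra_simps)

lemma dual_expand:
  assumes "vector_space s" "finite I"
    and span: "module.span s (e ` I) = V"
    and dual_basis: "\<And>i. i \<in> I \<Longrightarrow> e' i \<in> dual s V"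
      "\<And>i j. i \<in> I \<Longrightarrow> j \<in> I \<Longrightarrow> e' i (e j) = (if i = j then 1 else 0)"
    and u: "u \<in> dual s V"
  shows "u = (\<Sum>i\<in>I. fscale (u (e i)) (e' i))"
proof
  interpret vector_space s by fact
  let ?w = "\<Sum>i\<in>I. fscale (u (e i)) (e' i)"
  have w: "?w \<in> dual s V"
    using linear_on_sum[of fscale fscale "dual s V" "\<lambda>v. v" I e' "\<lambda>i. u (e i)"] dual_basis(1)
    by (auto simp: dual_closed linear_on_def)
  have sub: "subspace V"
    unfolding span[symmetric] by (rule subspace_span)
  have lin: "\<phi> (x + y) = \<phi> x + \<phi> y" "\<phi> (s c x) = c * \<phi> x"
    if "\<phi> \<in> dual s V" "x \<in> V" "y \<in> V" for \<phi> x y c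
    using that by (auto simp: dual_def linear_on_def)
  have zero: "\<phi> 0 = 0" if "\<phi> \<in> dual s V" for \<phi>
    using lin(2)[OF that subspace_0[OF sub] subspace_0[OF sub], of 0] by simp
  have inV: "u x = ?w x" if "x \<in> span (e ` I)" for x
  proof -
    have "x \<in> V \<and> u x = ?w x"
    using that
    proof (induction rule: span_induct_alt)
      case base
      show ?case using zero[OF u] zero[OF w] subspace_0[OF sub] by simp
    next
      case (step c x y)
      then obtain j where j: "j \<in> I" "x = e j" by auto
      have xV: "x \<in> V" using step(1) span span_base by blast
      have "?w x = (\<Sum>i\<in>I. u (e i) * (if i = j then 1 else 0))"
        unfolding sum_apply fscale_def using j dual_basis(2) by (intro sum.cong) auto
      also have "\<dots> = u x" using j assms(2) by (simp add: if_distrib sum.delta cong: if_cong)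
      finally have "?w x = u x" .
      then show ?case
        using step xV lin[OF u] lin[OF w] sub by (simp add: subspace_scale subspace_add)
    qed
    then show ?thesis ..
  qed
  show "u x = ?w x" for x
  proof (cases "x \<in> V")
    case False
    then show ?thesis using u w by (simp add: dual_def)
  qed (use inV span in auto)
qed

text \<open>
  The tensors \<open>e\<^sub>i \<otimes> e\<^sub>j\<close> span \<open>V \<otimes> V\<close>, and the coefficients are the values of the form on the
  dual basis; in particular they are unique.
\<close>

lemma tensor2_expand:
  assumes "fd_vector_space s V" "finite I"
    and span: "module.span s (e ` I) = V"
    and dual_basis: "\<And>i. i \<in> I \<Longrightarrow> e' i \<in> dual s V"
      "\<And>i j. i \<in> I \<Longrightarrow> j \<in> I \<Longrightarrow> e' i (e j) = (if i = j then 1 else 0)"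
    and t: "t \<in> tensor2 s V"
  shows "t = (\<Sum>i\<in>I. \<Sum>j\<in>I. fscale (t (e' i, e' j)) (tens s V (e i) (e j)))"
proof (rule ext, clarify)
  fix u v
  have vs: "vector_space s" using assms(1) by (simp add: fd_vector_space_def)
  show "t (u, v) = (\<Sum>i\<in>I. \<Sum>j\<in>I. fscale (t (e' i, e' j)) (tens s V (e i) (e j))) (u, v)"
  proof (cases "u \<in> dual s V \<and> v \<in> dual s V")
    case True
    have z: "t (u, 0) = 0" if "u \<in> dual s V" for u
    proof -
      have "linear_on fscale (*) (dual s V) (\<lambda>v. t (u, v))"
        using t that by (simp add: tensor2_def)
      then have "t (u, fscale 0 0) = 0 * t (u, 0)"
        using dual_closed(3) unfolding linear_on_def by blast
      moreover have "fscale 0 0 = (0 :: 'b \<Rightarrow> 'a)" by (auto simp: fscale_def)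
      ultimately show ?thesis by simp
    qed
    have z': "t (0, v) = 0" if "v \<in> dual s V" for v
    proof -
      have "linear_on fscale (*) (dual s V) (\<lambda>u. t (u, v))"
        using t that by (simp add: tensor2_def)
      then have "t (fscale 0 0, v) = 0 * t (0, v)"
        using dual_closed(3) unfolding linear_on_def by blast
      moreover have "fscale 0 0 = (0 :: 'b \<Rightarrow> 'a)" by (auto simp: fscale_def)
      ultimately show ?thesis by simp
    qed
    note du = dual_expand[OF vs assms(2) span dual_basis]
    have "t (u, v) = t (\<Sum>i\<in>I. fscale (u (e i)) (e' i), v)"
      using du[of u] True by simp
    also have "\<dots> = (\<Sum>i\<in>I. u (e i) * t (e' i, v))"
      using linear_on_sum[of fscale "(*)" "dual s V" "\<lambda>u. t (u, v)" I e' "\<lambda>i. u (e i)"] t True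
      by (simp add: tensor2_def dual_closed z' dual_basis(1))
    also have "\<dots> = (\<Sum>i\<in>I. u (e i) * (\<Sum>j\<in>I. v (e j) * t (e' i, e' j)))"
    proof (intro sum.cong refl)
      fix i assume "i \<in> I"
      then have i: "e' i \<in> dual s V" by (rule dual_basis)
      have "t (e' i, v) = t (e' i, \<Sum>j\<in>I. fscale (v (e j)) (e' j))"
        using du[of v] True by simp
      also have "\<dots> = (\<Sum>j\<in>I. v (e j) * t (e' i, e' j))"
        using linear_on_sum[of fscale "(*)" "dual s V" "\<lambda>v. t (e' i, v)" I e' "\<lambda>i. v (e i)"] t i
        by (simp add: tensor2_def dual_closed z dual_basis(1))
      finally show "u (e i) * t (e' i, v) = u (e i) * (\<Sum>j\<in>I. v (e j) * t (e' i, e' j))" by simp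
    qed
    finally show ?thesis
      using True by (simp add: sum_apply fscale_def tens_def ext0_def sum_distrib_left mult_ac)
  next
    case False
    then show ?thesis
      using t by (auto simp: sum_apply fscale_def tens_def ext0_def tensor2_def)
  qed
qed

text \<open>The left-hand side of the Yang-Baxter equation depends on \<open>r\<close> only.\<close>

lemma daybe_sum_eq:
  assumes V: "fd_vector_space s V" "bilinear_product s V rh" "bilinear_product s V lh"
    and ab: "\<And>i. i < n \<Longrightarrow> a i \<in> V \<and> b i \<in> V"
    and r: "r = (\<Sum>i<n. tens s V (a i) (b i))"
  shows "daybe_sum s V rh lh n a b = ext0 (dual s V \<times> dual s V \<times> dual s V) (\<lambda>(u, v, w).
    r (u, ext0 V (\<lambda>x. r (v, ext0 V (\<lambda>y. w (rh x y))))) -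
    r (ext0 V (\<lambda>x. r (u, ext0 V (\<lambda>y. v (lh x y)))), w) -
    r (ext0 V (\<lambda>x. r (ext0 V (\<lambda>y. u (star rh lh x y)), w)), v))"
proof (rule ext, clarify)
  fix u v w
  have r_apply: "r (p, q) = (\<Sum>i<n. p (a i) * q (b i))" if "p \<in> dual s V" "q \<in> dual s V" for p q
    using that by (simp add: r sum_apply tens_def ext0_def)
  note cl = subspace_closed[OF V(1)]
  have L: "ext0 V (\<lambda>y. p (m x y)) \<in> dual s V"
    if "p \<in> dual s V" "bilinear_product s V m" "x \<in> V" for p m x
    using dual_pull[of p s V "lmul m x"] that cl
    by (auto simp: bilinear_product_def lmul_def)
  have S: "bilinear_product s V (star rh lh)"
  proof -
    interpret vector_space s using V(1) by (simp add: fd_vector_space_def)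
    have "subspace V" using V(1) by (simp add: fd_vector_space_def)
    then show ?thesis using V(2,3)
      by (auto simp: bilinear_product_def star_def lmul_def rmul_def linear_on_def
        scale_right_diff_distrib subspace_diff algebra_simps)
  qed
  have R: "ext0 V (\<lambda>x. \<Sum>j<n. c j * p (m x (d j))) \<in> dual s V"
    if "p \<in> dual s V" "bilinear_product s V m" "\<And>j. j < n \<Longrightarrow> d j \<in> V" for p m c d
    using that cl
    by (auto simp: dual_def linear_on_def ext0_def bilinear_product_def rmul_def
      sum.distrib[symmetric] sum_distrib_left algebra_simps intro!: sum.cong)
  let ?rhs = "\<lambda>(u, v, w).
    r (u, ext0 V (\<lambda>x. r (v, ext0 V (\<lambda>y. w (rh x y))))) -
    r (ext0 V (\<lambda>x. r (u, ext0 V (\<lambda>y. v (lh x y)))), w) -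
    r (ext0 V (\<lambda>x. r (ext0 V (\<lambda>y. u (star rh lh x y)), w)), v)"
  show "daybe_sum s V rh lh n a b (u, v, w) =
      ext0 (dual s V \<times> dual s V \<times> dual s V) ?rhs (u, v, w)"
  proof (cases "u \<in> dual s V \<and> v \<in> dual s V \<and> w \<in> dual s V")
    case True
    have 1: "ext0 V (\<lambda>x. r (v, ext0 V (\<lambda>y. w (rh x y)))) =
        ext0 V (\<lambda>x. \<Sum>j<n. v (a j) * w (rh x (b j)))"
      using True V L ab by (auto simp: ext0_def[of V] r_apply[OF _ L[unfolded ext0_def]] fun_eq_iff)
    have 2: "ext0 V (\<lambda>x. r (u, ext0 V (\<lambda>y. v (lh x y)))) =
        ext0 V (\<lambda>x. \<Sum>j<n. u (a j) * v (lh x (b j)))"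
      using True V L ab by (auto simp: ext0_def[of V] r_apply[OF _ L[unfolded ext0_def]] fun_eq_iff)
    have 3: "ext0 V (\<lambda>x. r (ext0 V (\<lambda>y. u (star rh lh x y)), w)) =
        ext0 V (\<lambda>x. \<Sum>j<n. w (b j) * u (star rh lh x (a j)))"
      using True S L ab
      by (auto simp: ext0_def[of V] r_apply[OF L[unfolded ext0_def]] fun_eq_iff mult_ac)
    have 4: "r (u, ext0 V (\<lambda>x. r (v, ext0 V (\<lambda>y. w (rh x y))))) =
        (\<Sum>i<n. \<Sum>j<n. u (a i) * v (a j) * w (rh (b i) (b j)))"
      unfolding 1 using True V ab
      by (subst r_apply) (auto intro!: R[unfolded ext0_def] sum.cong simp: sum_distrib_left ext0_def[of V] mult_ac)
    have 5: "r (ext0 V (\<lambda>x. r (u, ext0 V (\<lambda>y. v (lh x y)))), w) =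
        (\<Sum>i<n. \<Sum>j<n. u (a j) * v (lh (a i) (b j)) * w (b i))"
      unfolding 2 using True V ab
      by (subst r_apply)
        (auto intro!: R[unfolded ext0_def] sum.cong simp: sum_distrib_left sum_distrib_right ext0_def[of V] mult_ac)
    have 6: "r (ext0 V (\<lambda>x. r (ext0 V (\<lambda>y. u (star rh lh x y)), w)), v) =
        (\<Sum>i<n. \<Sum>j<n. u (star rh lh (a i) (a j)) * v (b i) * w (b j))"
      unfolding 3 using True S ab
      by (subst r_apply)
        (auto intro!: R[unfolded ext0_def] sum.cong simp: sum_distrib_left sum_distrib_right ext0_def[of V] mult_ac)
    have "daybe_sum s V rh lh n a b (u, v, w) =
        (\<Sum>i<n. \<Sum>j<n. u (a i) * v (a j) * w (rh (b i) (b j)) -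
          u (a j) * v (lh (a i) (b j)) * w (b i) - u (star rh lh (a i) (a j)) * v (b i) * w (b j))"
      using True by (simp add: daybe_sum_def sum_apply tens3_def ext0_def)
    then show ?thesis
      using True by (simp add: ext0_def[of "_ \<times> _"] 4 5 6 sum_subtractf)
  next
    case False
    then show ?thesis
      by (auto simp: daybe_sum_def sum_apply tens3_def ext0_def)
  qed
qed

lemma daybe_independent:
  assumes "fd_vector_space s V" "bilinear_product s V rh" "bilinear_product s V lh"
    and "\<And>i. i < n \<Longrightarrow> a i \<in> V \<and> b i \<in> V" "\<And>i. i < m \<Longrightarrow> a' i \<in> V \<and> b' i \<in> V"
    and "(\<Sum>i<n. tens s V (a i) (b i)) = (\<Sum>i<m. tens s V (a' i) (b' i))"
  shows "daybe_sum s V rh lh n a b = daybe_sum s V rh lh m a' b'"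
  using daybe_sum_eq[OF assms(1-4) refl] daybe_sum_eq[OF assms(1-3,5,6)] by simp

end

theory Submission
  imports Defs
begin

text \<open>
  On \<open>D = A \<oplus> A\<^sup>*\<close> consider the skew form \<open>\<omega>(x + a, y + b) = \<langle>a, y\<rangle> - \<langle>b, x\<rangle>\<close>.  The
  products of the double are made so that \<open>\<omega>(u \<lhd> v, w) = -\<omega>(v \<rhd> w, u)\<close> and the cyclic sum of
  \<open>\<omega>(u \<rhd> v, w)\<close> vanishes.  Such invariance turns the dialgebra axioms of \<open>D\<close> into three
  identities for \<open>\<omega>(u \<diamond> v, w \<diamond>' t)\<close>.  When three or four of the arguments lie in the same summand
  these are the dialgebra axioms of \<open>A\<close> and \<open>A\<^sup>*\<close>; the case of two arguments in each summand is a
  combination of the nine compatibility conditions of the bi-dialgebra.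

  Let \<open>P\<close> and \<open>Q\<close> be the projections of \<open>D\<close> to \<open>A\<close> and \<open>A\<^sup>*\<close>.  Identifying \<open>D\<^sup>*\<close> with \<open>D\<close> by
  \<open>\<omega>\<close>, the tensor \<open>r\<close> becomes \<open>(u, v) \<mapsto> \<omega>(P v, u)\<close>, its skew-symmetric part becomes
  \<open>-\<omega>\<close>, and the products dual to the coproducts given by \<open>r\<close> become
  \<open>u \<diamond>\<^sub>r v = Q u \<diamond> v - u \<diamond> P v = Q u \<diamond> Q v - P u \<diamond> P v\<close>.  So coassociativity is
  associativity on a direct sum, and the remaining axioms follow from the invariance of \<open>\<omega>\<close> and
  the isotropy of the two summands.
\<close>

section \<open>Invariant skew-symmetric forms\<close>

lemma tensor2_add: "t \<in> tensor2 s V \<Longrightarrow> t' \<in> tensor2 s V \<Longrightarrow> t + t' \<in> tensor2 s V"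
  and tensor2_diff: "t \<in> tensor2 s V \<Longrightarrow> t' \<in> tensor2 s V \<Longrightarrow> t - t' \<in> tensor2 s V"
  and tensor2_zero: "0 \<in> tensor2 s V"
  by (auto simp: tensor2_def linear_on_def algebra_simps)

lemma tensor2_sum: "(\<And>i. i \<in> I \<Longrightarrow> t i \<in> tensor2 s V) \<Longrightarrow> (\<Sum>i\<in>I. t i) \<in> tensor2 s V"
  by (induction I rule: infinite_finite_induct) (auto simp: tensor2_zero tensor2_add)

lemma tmap_tensor2:
  assumes V: "fd_vector_space s V"
    and f: "linear_on s s V f" "\<And>x. x \<in> V \<Longrightarrow> f x \<in> V"
    and g: "linear_on s s V g" "\<And>x. x \<in> V \<Longrightarrow> g x \<in> V"
    and t: "t \<in> tensor2 s V"
  shows "tmap s V f g t \<in> tensor2 s V"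
proof -
  have pull: "ext0 V (\<lambda>x. u (h x)) \<in> dual s V"
    if "u \<in> dual s V" "linear_on s s V h" "\<And>x. x \<in> V \<Longrightarrow> h x \<in> V" for u h
    by (rule dual_pull[OF that subspace_closed(1,2)[OF V]])
  have add: "ext0 V (\<lambda>x. (u + v) (h x)) = ext0 V (\<lambda>x. u (h x)) + ext0 V (\<lambda>x. v (h x))"
    for u v :: "'b \<Rightarrow> 'a" and h by (auto simp: ext0_def)
  have scale: "ext0 V (\<lambda>x. fscale c u (h x)) = fscale c (ext0 V (\<lambda>x. u (h x)))"
    for u :: "'b \<Rightarrow> 'a" and h c by (auto simp: ext0_def fscale_def)
  show ?thesis
    using t pull[OF _ f] pull[OF _ g]
    unfolding tensor2_def linear_on_def tmap_def
    by (simp add: ext0_def[of "_ \<times> _"] dual_closed add scale del: plus_fun_apply)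
qed

text \<open>\<open>om_lh\<close> and \<open>om_cyclic\<close> are the invariance of the form. By
  \<open>om_dual\<close> every covector has the shape \<open>om u\<close>, so tensors on
  \<open>V\<close> need only be evaluated at elements of \<open>V\<close>.\<close>

locale invariant_form =
  fixes s :: "'f::field \<Rightarrow> 'v::ab_group_add \<Rightarrow> 'v"
    and V :: "'v set"
    and rh lh :: "'v \<Rightarrow> 'v \<Rightarrow> 'v"
    and om :: "'v \<Rightarrow> 'v \<Rightarrow> 'f"
  assumes fd: "fd_vector_space s V"
    and bilin_rh: "bilinear_product s V rh"
    and bilin_lh: "bilinear_product s V lh"
    and om_add: "\<And>u v w. u \<in> V \<Longrightarrow> v \<in> V \<Longrightarrow> w \<in> V \<Longrightarrow> om u (v + w) = om u v + om u w"
    and om_scale: "\<And>u v c. u \<in> V \<Longrightarrow> v \<in> V \<Longrightarrow> om u (s c v) = c * om u v"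
    and om_skew: "\<And>u v. u \<in> V \<Longrightarrow> v \<in> V \<Longrightarrow> om u v = - om v u"
    and om_nondeg: "\<And>u. u \<in> V \<Longrightarrow> (\<And>v. v \<in> V \<Longrightarrow> om u v = 0) \<Longrightarrow> u = 0"
    and om_dual: "\<And>\<phi>. \<phi> \<in> dual s V \<Longrightarrow> \<exists>u\<in>V. \<phi> = ext0 V (om u)"
    and om_lh: "\<And>u v w. u \<in> V \<Longrightarrow> v \<in> V \<Longrightarrow> w \<in> V \<Longrightarrow> om (lh u v) w = - om (rh v w) u"
    and om_cyclic: "\<And>u v w. u \<in> V \<Longrightarrow> v \<in> V \<Longrightarrow> w \<in> V \<Longrightarrow>
      om (rh u v) w + om (rh v w) u + om (rh w u) v = 0"
begin

section \<open>Linearity of the products and of the form, and adjoints of the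
  multiplications\<close>

abbreviation st where "st \<equiv> star rh lh"

sublocale vector_space s using fd by (simp add: fd_vector_space_def)

lemma subspace_V: "subspace V" using fd by (simp add: fd_vector_space_def)

lemma closed [simp]:
  "u \<in> V \<Longrightarrow> v \<in> V \<Longrightarrow> u + v \<in> V" "u \<in> V \<Longrightarrow> v \<in> V \<Longrightarrow> u - v \<in> V"
  "u \<in> V \<Longrightarrow> - u \<in> V" "u \<in> V \<Longrightarrow> s c u \<in> V" "0 \<in> V"
  "u \<in> V \<Longrightarrow> v \<in> V \<Longrightarrow> rh u v \<in> V" "u \<in> V \<Longrightarrow> v \<in> V \<Longrightarrow> lh u v \<in> V"
  "u \<in> V \<Longrightarrow> v \<in> V \<Longrightarrow> st u v \<in> V"
  using subspace_V bilin_rh bilin_lh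
  by (auto simp: subspace_add subspace_diff subspace_neg subspace_scale subspace_0
      bilinear_product_def star_def)

lemma product_add:
  "u \<in> V \<Longrightarrow> v \<in> V \<Longrightarrow> w \<in> V \<Longrightarrow> rh (u + v) w = rh u w + rh v w"
  "u \<in> V \<Longrightarrow> v \<in> V \<Longrightarrow> w \<in> V \<Longrightarrow> rh u (v + w) = rh u v + rh u w"
  "u \<in> V \<Longrightarrow> v \<in> V \<Longrightarrow> w \<in> V \<Longrightarrow> lh (u + v) w = lh u w + lh v w"
  "u \<in> V \<Longrightarrow> v \<in> V \<Longrightarrow> w \<in> V \<Longrightarrow> lh u (v + w) = lh u v + lh u w"
  "u \<in> V \<Longrightarrow> v \<in> V \<Longrightarrow> w \<in> V \<Longrightarrow> st (u + v) w = st u w + st v w"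
  "u \<in> V \<Longrightarrow> v \<in> V \<Longrightarrow> w \<in> V \<Longrightarrow> st u (v + w) = st u v + st u w"
  using bilin_rh bilin_lh
  by (auto simp: bilinear_product_def star_def linear_on_def lmul_def rmul_def)

lemma product_scale:
  "u \<in> V \<Longrightarrow> v \<in> V \<Longrightarrow> rh (s c u) v = s c (rh u v)"
  "u \<in> V \<Longrightarrow> v \<in> V \<Longrightarrow> rh u (s c v) = s c (rh u v)"
  "u \<in> V \<Longrightarrow> v \<in> V \<Longrightarrow> lh (s c u) v = s c (lh u v)"
  "u \<in> V \<Longrightarrow> v \<in> V \<Longrightarrow> lh u (s c v) = s c (lh u v)"
  using bilin_rh bilin_lh
  by (auto simp: bilinear_product_def linear_on_def lmul_def rmul_def)

lemma product_minus:
  assumes "u \<in> V" "v \<in> V"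
  shows "rh (- u) v = - rh u v" "rh u (- v) = - rh u v"
    "lh (- u) v = - lh u v" "lh u (- v) = - lh u v"
  using product_scale[OF assms, of "- 1"] by simp_all

lemma product_diff:
  assumes "u \<in> V" "v \<in> V" "w \<in> V"
  shows "rh (u - v) w = rh u w - rh v w" "rh u (v - w) = rh u v - rh u w"
    "lh (u - v) w = lh u w - lh v w" "lh u (v - w) = lh u v - lh u w"
  using product_add[of u "- v" w] product_add[of u v "- w"] assms
  by (simp_all add: product_minus)

lemma om_minus: "u \<in> V \<Longrightarrow> v \<in> V \<Longrightarrow> om u (- v) = - om u v"
  using om_scale[of u v "- 1"] by simp

lemma om_diff: "u \<in> V \<Longrightarrow> v \<in> V \<Longrightarrow> w \<in> V \<Longrightarrow> om u (v - w) = om u v - om u w"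
  using om_add[of u v "- w"] by (simp add: om_minus)

lemma om_left:
  "u \<in> V \<Longrightarrow> v \<in> V \<Longrightarrow> w \<in> V \<Longrightarrow> om (u + v) w = om u w + om v w"
  "u \<in> V \<Longrightarrow> v \<in> V \<Longrightarrow> w \<in> V \<Longrightarrow> om (u - v) w = om u w - om v w"
  "u \<in> V \<Longrightarrow> v \<in> V \<Longrightarrow> om (- u) v = - om u v"
  "u \<in> V \<Longrightarrow> v \<in> V \<Longrightarrow> om (s c u) v = c * om u v"
  "u \<in> V \<Longrightarrow> om 0 u = 0"
proof -
  have skew: "om x y = - om y x" if "x \<in> V" "y \<in> V" for x y
    using that by (rule om_skew)
  show "om (u + v) w = om u w + om v w" "om (u - v) w = om u w - om v w"
    if "u \<in> V" "v \<in> V" "w \<in> V"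
    using that by (simp_all add: skew[where y = w] om_add om_diff)
  show "om (- u) v = - om u v" "om (s c u) v = c * om u v" if "u \<in> V" "v \<in> V"
    using that by (simp_all add: skew[where y = v] om_minus om_scale)
  show "om 0 u = 0" if "u \<in> V"
    using that om_scale[of u 0 0] by (simp add: skew[where y = u])
qed

lemmas om_linear = om_add om_diff om_minus om_scale om_left

lemma om_eqI: "u \<in> V \<Longrightarrow> v \<in> V \<Longrightarrow> (\<And>w. w \<in> V \<Longrightarrow> om u w = om v w) \<Longrightarrow> u = v"
  using om_nondeg[of "u - v"] by (simp add: om_linear)

text \<open>These are the adjoints of the left and right multiplications. Rotations of
  \<open>om_lh\<close> trade pairings with \<open>lh\<close> for pairings with \<open>rh\<close>,
  and the cyclic sum supplies the remaining linear relation.\<close>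

lemma om_transfer:
  assumes "u \<in> V" "v \<in> V" "w \<in> V"
  shows "om (rh u v) w = om u (st v w)" "om (lh u v) w = om u (rh v w)"
    "om (rh u v) w = om v (lh w u)" "om (lh u v) w = - om v (st w u)"
proof -
  have c: "om (rh u v) w = - om (rh v w) u - om (rh w u) v"
    using om_cyclic[OF assms] by algebra
  have l: "om (lh u v) w = - om (rh v w) u" "om (rh w u) v = - om (lh v w) u"
    "om (rh u v) w = - om (lh w u) v"
    using om_lh[of u v w] om_lh[of v w u] om_lh[of w u v] assms by simp_all
  have k: "om u (rh v w) = - om (rh v w) u" "om u (lh v w) = - om (lh v w) u"
    "om v (rh w u) = - om (rh w u) v" "om v (lh w u) = - om (lh w u) v"
    using assms by (auto intro: om_skew)
  show "om (rh u v) w = om u (st v w)"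
    using c assms by (simp add: star_def om_diff k l(2))
  show "om (lh u v) w = om u (rh v w)" "om (rh u v) w = om v (lh w u)"
    by (simp_all add: k l)
  have "om (lh w u) v = om (rh v w) u - om (lh v w) u"
    using c l by algebra
  then show "om (lh u v) w = - om v (st w u)"
    using assms by (simp add: star_def om_diff k l)
qed

lemma om_star_transfer:
  assumes "u \<in> V" "v \<in> V" "w \<in> V"
  shows "om (st u v) w = - om u (lh v w)" "om (st u v) w = om v (rh w u)"
proof -
  show "om (st u v) w = - om u (lh v w)"
    using om_transfer(1,2)[OF assms] assms by (simp add: star_def om_left om_diff)
  show "om (st u v) w = om v (rh w u)"
    using om_transfer(3,4)[OF assms] assms by (simp add: star_def om_left om_diff)
qed

text \<open>Moving the outer product across the form turns each axiom into a relation between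
  pairings of two products. \<open>E\<close> is associativity of \<open>rh\<close>, \<open>F\<close>
  is the axiom for \<open>lh (rh u v) w\<close>, and a rotation of \<open>E\<close> with
  skew-symmetry gives \<open>lh (lh u v) w = lh u (rh v w)\<close>. By \<open>S\<close> an inner
  \<open>lh\<close> paired with a \<open>st\<close> may be exchanged for \<open>rh\<close>, which
  yields the other two axioms.\<close>

lemma dialgebraI:
  assumes S: "\<And>u v w t. u \<in> V \<Longrightarrow> v \<in> V \<Longrightarrow> w \<in> V \<Longrightarrow> t \<in> V \<Longrightarrow> om (st u v) (st w t) = 0"
    and E: "\<And>u v w t. u \<in> V \<Longrightarrow> v \<in> V \<Longrightarrow> w \<in> V \<Longrightarrow> t \<in> V \<Longrightarrow>
      om (rh u v) (st w t) = om (rh v w) (lh t u)"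
    and F: "\<And>u v w t. u \<in> V \<Longrightarrow> v \<in> V \<Longrightarrow> w \<in> V \<Longrightarrow> t \<in> V \<Longrightarrow>
      om (rh u v) (rh w t) = om (lh v w) (lh t u)"
  shows "dialgebra s V rh lh"
proof -
  have 1: "rh (rh u v) w = rh u (rh v w)" if V: "u \<in> V" "v \<in> V" "w \<in> V" for u v w
  proof (rule om_eqI)
    fix t assume t: "t \<in> V"
    show "om (rh (rh u v) w) t = om (rh u (rh v w)) t"
      using E[OF V t] om_transfer(1)[of "rh u v" w t] om_transfer(3)[of u "rh v w" t] V t by simp
  qed (use V in simp_all)
  have 4: "lh (rh u v) w = rh u (lh v w)" if V: "u \<in> V" "v \<in> V" "w \<in> V" for u v w
  proof (rule om_eqI)
    fix t assume t: "t \<in> V"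
    show "om (lh (rh u v) w) t = om (rh u (lh v w)) t"
      using F[OF V t] om_transfer(2)[of "rh u v" w t] om_transfer(3)[of u "lh v w" t] V t by simp
  qed (use V in simp_all)
  have 5: "rh (lh u v) w = rh u (rh v w)" if V: "u \<in> V" "v \<in> V" "w \<in> V" for u v w
  proof (rule om_eqI)
    fix t assume t: "t \<in> V"
    have eq: "om (lh u v) (st w t) = om (rh u v) (st w t)"
      using V t S[OF V t] by (simp add: star_def[of _ _ u v] om_left)
    show "om (rh (lh u v) w) t = om (rh u (rh v w)) t"
      using eq E[OF V t] om_transfer(1)[of "lh u v" w t] om_transfer(3)[of u "rh v w" t] V t by simp
  qed (use V in simp_all)
  have 3: "lh (lh u v) w = lh u (rh v w)" if V: "u \<in> V" "v \<in> V" "w \<in> V" for u v w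
  proof (rule om_eqI)
    fix t assume t: "t \<in> V"
    show "om (lh (lh u v) w) t = om (lh u (rh v w)) t"
      using E[OF V(2,3) t V(1)] om_skew[of "lh u v" "rh w t"]
        om_transfer(2)[of "lh u v" w t] om_transfer(4)[of u "rh v w" t] V t by simp
  qed (use V in simp_all)
  have 2: "lh (lh u v) w = lh u (lh v w)" if V: "u \<in> V" "v \<in> V" "w \<in> V" for u v w
  proof (rule om_eqI)
    fix t assume t: "t \<in> V"
    have eq: "om (lh v w) (st t u) = om (rh v w) (st t u)"
      using V t S[OF V(2,3) t V(1)] by (simp add: star_def[of _ _ v w] om_left)
    show "om (lh (lh u v) w) t = om (lh u (lh v w)) t"
      using eq 3[OF V] om_transfer(4)[of u "rh v w" t] om_transfer(4)[of u "lh v w" t] V t by simp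
  qed (use V in simp_all)
  show ?thesis
    unfolding dialgebra_def
    by (intro conjI ballI fd bilin_rh bilin_lh) (rule 1 2 3 4 5; assumption)+
qed

text \<open>\<open>G\<close> will be the union of two complementary subspaces. It is not itself a
  subspace, but every vector is a sum of two of its elements, so additivity lifts the restriction to
  \<open>G\<close> one slot at a time, the last slot first.\<close>

lemma quadrilinear_zero:
  assumes G: "G \<subseteq> V" "\<And>u. u \<in> V \<Longrightarrow> \<exists>p\<in>G. \<exists>q\<in>G. u = p + q"
    and K: "\<And>u u' v w t. u \<in> V \<Longrightarrow> u' \<in> V \<Longrightarrow> v \<in> V \<Longrightarrow> w \<in> V \<Longrightarrow> t \<in> V \<Longrightarrow>
        K (u + u') v w t = K u v w t + K u' v w t"
      "\<And>u v v' w t. u \<in> V \<Longrightarrow> v \<in> V \<Longrightarrow> v' \<in> V \<Longrightarrow> w \<in> V \<Longrightarrow> t \<in> V \<Longrightarrow>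
        K u (v + v') w t = K u v w t + K u v' w t"
      "\<And>u v w w' t. u \<in> V \<Longrightarrow> v \<in> V \<Longrightarrow> w \<in> V \<Longrightarrow> w' \<in> V \<Longrightarrow> t \<in> V \<Longrightarrow>
        K u v (w + w') t = K u v w t + K u v w' t"
      "\<And>u v w t t'. u \<in> V \<Longrightarrow> v \<in> V \<Longrightarrow> w \<in> V \<Longrightarrow> t \<in> V \<Longrightarrow> t' \<in> V \<Longrightarrow>
        K u v w (t + t') = K u v w t + K u v w t'"
    and 0: "\<And>u v w t. u \<in> G \<Longrightarrow> v \<in> G \<Longrightarrow> w \<in> G \<Longrightarrow> t \<in> G \<Longrightarrow> K u v w t = (0 :: 'f)"
    and V: "u \<in> V" "v \<in> V" "w \<in> V" "t \<in> V"
  shows "K u v w t = 0"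
proof -
  have 1: "K u v w t = 0" if "u \<in> G" "v \<in> G" "w \<in> G" "t \<in> V" for u v w t
    using G(2)[OF that(4)] that G(1) K(4) 0 by (force simp: subset_iff)
  have 2: "K u v w t = 0" if "u \<in> G" "v \<in> G" "w \<in> V" "t \<in> V" for u v w t
    using G(2)[OF that(3)] that G(1) K(3) 1 by (force simp: subset_iff)
  have 3: "K u v w t = 0" if "u \<in> G" "v \<in> V" "w \<in> V" "t \<in> V" for u v w t
    using G(2)[OF that(2)] that G(1) K(2) 2 by (force simp: subset_iff)
  show ?thesis
    using G(2)[OF V(1)] V G(1) K(1) 3 by (force simp: subset_iff)
qed

lemma dialgebraI_generators:
  assumes G: "G \<subseteq> V" "\<And>u. u \<in> V \<Longrightarrow> \<exists>p\<in>G. \<exists>q\<in>G. u = p + q"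
    and S: "\<And>u v w t. u \<in> G \<Longrightarrow> v \<in> G \<Longrightarrow> w \<in> G \<Longrightarrow> t \<in> G \<Longrightarrow> om (st u v) (st w t) = 0"
    and E: "\<And>u v w t. u \<in> G \<Longrightarrow> v \<in> G \<Longrightarrow> w \<in> G \<Longrightarrow> t \<in> G \<Longrightarrow>
      om (rh u v) (st w t) = om (rh v w) (lh t u)"
    and F: "\<And>u v w t. u \<in> G \<Longrightarrow> v \<in> G \<Longrightarrow> w \<in> G \<Longrightarrow> t \<in> G \<Longrightarrow>
      om (rh u v) (rh w t) = om (lh v w) (lh t u)"
  shows "dialgebra s V rh lh"
proof (rule dialgebraI)
  fix u v w t assume V: "u \<in> V" "v \<in> V" "w \<in> V" "t \<in> V"
  show "om (st u v) (st w t) = 0"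
    by (rule quadrilinear_zero[where K = "\<lambda>u v w t. om (st u v) (st w t)", OF G])
      (use V S in \<open>auto simp: product_add om_linear\<close>)
  have "om (rh u v) (st w t) - om (rh v w) (lh t u) = 0"
    by (rule quadrilinear_zero[where K = "\<lambda>u v w t. om (rh u v) (st w t) - om (rh v w) (lh t u)", OF G])
      (use V E in \<open>auto simp: product_add om_linear\<close>)
  then show "om (rh u v) (st w t) = om (rh v w) (lh t u)" by simp
  have "om (rh u v) (rh w t) - om (lh v w) (lh t u) = 0"
    by (rule quadrilinear_zero[where K = "\<lambda>u v w t. om (rh u v) (rh w t) - om (lh v w) (lh t u)", OF G])
      (use V F in \<open>auto simp: product_add om_linear\<close>)
  then show "om (rh u v) (rh w t) = om (lh v w) (lh t u)" by simp
qed

end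

section \<open>The tensor of a Lagrangian splitting\<close>

text \<open>Isotropy of both images says that the adjoint of \<open>P\<close> is
  \<open>id - P\<close>; with nondegeneracy this forces \<open>P\<close> to be idempotent.
  \<open>P_expand\<close> identifies the form that the tensor with legs \<open>a\<close> and
  \<open>b\<close> becomes under \<open>om\<close>.\<close>

locale lagrangian_splitting = invariant_form +
  fixes P :: "'b \<Rightarrow> 'b" and n :: nat and a b :: "nat \<Rightarrow> 'b"
  assumes dialg: "dialgebra s V rh lh"
    and P_closed [simp]: "\<And>u. u \<in> V \<Longrightarrow> P u \<in> V"
    and P_linear: "linear_on s s V P"
    and P_isotropic: "\<And>u v. u \<in> V \<Longrightarrow> v \<in> V \<Longrightarrow> om (P u) (P v) = 0"
    and Q_isotropic: "\<And>u v. u \<in> V \<Longrightarrow> v \<in> V \<Longrightarrow> om (u - P u) (v - P v) = 0"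
    and P_product: "\<And>u v. u \<in> V \<Longrightarrow> v \<in> V \<Longrightarrow> P (rh (P u) (P v)) = rh (P u) (P v)"
      "\<And>u v. u \<in> V \<Longrightarrow> v \<in> V \<Longrightarrow> P (lh (P u) (P v)) = lh (P u) (P v)"
    and Q_product: "\<And>u v. u \<in> V \<Longrightarrow> v \<in> V \<Longrightarrow> P (rh (u - P u) (v - P v)) = 0"
      "\<And>u v. u \<in> V \<Longrightarrow> v \<in> V \<Longrightarrow> P (lh (u - P u) (v - P v)) = 0"
    and ab_closed: "\<And>i. i < n \<Longrightarrow> a i \<in> V" "\<And>i. i < n \<Longrightarrow> b i \<in> V"
    and P_expand: "\<And>u v. u \<in> V \<Longrightarrow> v \<in> V \<Longrightarrow> (\<Sum>i<n. om u (a i) * om v (b i)) = om (P v) u"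
begin

lemma P_simps:
  "u \<in> V \<Longrightarrow> v \<in> V \<Longrightarrow> P (u + v) = P u + P v"
  "u \<in> V \<Longrightarrow> P (s c u) = s c (P u)"
  "u \<in> V \<Longrightarrow> P (- u) = - P u"
  "u \<in> V \<Longrightarrow> v \<in> V \<Longrightarrow> P (u - v) = P u - P v"
proof -
  show add: "P (u + v) = P u + P v" if "u \<in> V" "v \<in> V" for u v
    using that P_linear by (simp add: linear_on_def)
  show sc: "P (s c u) = s c (P u)" if "u \<in> V" for u c
    using that P_linear by (simp add: linear_on_def)
  show neg: "P (- u) = - P u" if "u \<in> V" for u
    using sc[OF that, of "- 1"] by simp
  show "P (u - v) = P u - P v" if "u \<in> V" "v \<in> V" for u v
    using add[of u "- v"] that by (simp add: neg)
qed

text \<open>The adjoint of \<open>P\<close> is \<open>Q\<close>: expand the isotropy of the image of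
  \<open>Q\<close> and drop the term with two occurrences of \<open>P\<close>.\<close>

lemma om_P: "u \<in> V \<Longrightarrow> v \<in> V \<Longrightarrow> om (P u) v = om u v - om u (P v)"
  using P_isotropic[of u v] Q_isotropic[of u v] by (simp add: om_linear) algebra

text \<open>The axioms are oriented as rewrite rules: brackets move to the right, and in
  \<open>lh u (rh v w)\<close> the inner product becomes \<open>lh\<close>.\<close>

lemma assoc:
  assumes "u \<in> V" "v \<in> V" "w \<in> V"
  shows "rh (rh u v) w = rh u (rh v w)" "lh (lh u v) w = lh u (lh v w)"
    "lh u (rh v w) = lh u (lh v w)" "lh (rh u v) w = rh u (lh v w)" "rh (lh u v) w = rh u (rh v w)"
proof -
  show "rh (rh u v) w = rh u (rh v w)" "lh (rh u v) w = rh u (lh v w)" "rh (lh u v) w = rh u (rh v w)"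
    and l: "lh (lh u v) w = lh u (lh v w)"
    using dialg assms unfolding dialgebra_def by blast+
  have "lh (lh u v) w = lh u (rh v w)"
    using dialg assms unfolding dialgebra_def by blast
  then show "lh u (rh v w) = lh u (lh v w)" using l by simp
qed

text \<open>The converse direction of \<open>dialgebraI\<close>: associativity is read through the
  adjoints as identities for the form.\<close>

lemma om_shift:
  assumes "u \<in> V" "v \<in> V" "w \<in> V" "t \<in> V"
  shows "om (rh u v) (rh w t) = om (lh v w) (lh t u)"
    "om (rh u v) (st w t) = om (rh v w) (lh t u)"
    "om (lh u v) (st w t) = om (rh v w) (lh t u)"
proof -
  show "om (rh u v) (rh w t) = om (lh v w) (lh t u)"
    using assms om_transfer(2)[of "rh u v" w t] om_transfer(3)[of u "lh v w" t] by (simp add: assoc)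
  show "om (rh u v) (st w t) = om (rh v w) (lh t u)"
    using assms om_transfer(1)[of "rh u v" w t] om_transfer(3)[of u "rh v w" t] by (simp add: assoc)
  show "om (lh u v) (st w t) = om (rh v w) (lh t u)"
    using assms om_transfer(1)[of "lh u v" w t] om_transfer(3)[of u "rh v w" t] by (simp add: assoc)
qed

text \<open>For a fixed cyclic order of the four arguments there are sixteen pairings of two
  products of neighbours. With \<open>st\<close> expanded, \<open>om_shift\<close> and skew-symmetry
  are linear equations that express all of them by \<open>A\<close>, \<open>B\<close> and
  \<open>C\<close>. This gives a normal form in which identities are decided by
  simplification.\<close>

lemma om_quad:
  assumes V: "u \<in> V" "v \<in> V" "w \<in> V" "t \<in> V"
  defines "A \<equiv> om (rh u v) (rh w t)" and "B \<equiv> om (rh u v) (lh w t)" and "C \<equiv> om (lh u v) (rh w t)"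
  shows "om (lh u v) (lh w t) = B + C - A"
    "om (rh w t) (rh u v) = - A" "om (lh w t) (rh u v) = - B" "om (rh w t) (lh u v) = - C"
    "om (lh w t) (lh u v) = A - B - C"
    "om (rh v w) (rh t u) = A - B - C" "om (rh v w) (lh t u) = A - B"
    "om (lh v w) (rh t u) = A - C" "om (lh v w) (lh t u) = A"
    "om (rh t u) (rh v w) = B + C - A" "om (lh t u) (rh v w) = B - A"
    "om (rh t u) (lh v w) = C - A" "om (lh t u) (lh v w) = - A"
proof -
  have sk: "om (f x y) (g p q) = - om (g p q) (f x y)"
    if "x \<in> V" "y \<in> V" "p \<in> V" "q \<in> V" "f \<in> {rh, lh}" "g \<in> {rh, lh}" for f g x y p q
    using that by (intro om_skew) auto
  have 1: "om (rh u v) (rh w t) = A" "om (rh u v) (lh w t) = B" "om (lh u v) (rh w t) = C"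
    by (simp_all add: A_def B_def C_def)
  have d: "om (rh u v) (rh w t) - om (rh u v) (lh w t) = om (rh v w) (lh t u)"
    "om (lh u v) (rh w t) - om (lh u v) (lh w t) = om (rh v w) (lh t u)"
    "om (rh v w) (rh t u) - om (rh v w) (lh t u) = om (rh w t) (lh u v)"
    "om (rh w t) (rh u v) - om (rh w t) (lh u v) = om (rh t u) (lh v w)"
    using om_shift(2,3)[OF V] om_shift(2)[OF V(2,3,4,1)] om_shift(2)[OF V(3,4,1,2)] V
    by (simp_all add: star_def om_diff)
  show 2: "om (rh w t) (rh u v) = - A" "om (lh w t) (rh u v) = - B" "om (rh w t) (lh u v) = - C"
    using 1 V sk[of w t u v] by simp_all
  have "om (lh u v) (lh w t) = C - (om (lh u v) (rh w t) - om (lh u v) (lh w t))"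
    by (simp add: C_def)
  then show 3: "om (lh u v) (lh w t) = B + C - A"
    unfolding d(2) d(1)[symmetric] by (simp add: 1 algebra_simps)
  then show "om (lh w t) (lh u v) = A - B - C" using V sk[of w t u v lh lh] by simp
  show 4: "om (rh v w) (lh t u) = A - B" "om (lh v w) (lh t u) = A"
    using d(1) om_shift(1)[OF V] 1 by simp_all
  then show "om (lh t u) (rh v w) = B - A" "om (lh t u) (lh v w) = - A"
    using V sk[of t u v w] by simp_all
  show 5: "om (rh v w) (rh t u) = A - B - C" using d(3) by (simp add: 2 4 algebra_simps)
  then show "om (rh t u) (rh v w) = B + C - A" using V sk[of t u v w rh rh] by simp
  show 6: "om (rh t u) (lh v w) = C - A" using d(4) by (simp add: 2 algebra_simps)
  then show "om (lh v w) (rh t u) = A - C" using V sk[of v w t u lh rh] by simp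
qed

section \<open>The tensor \<open>r\<close>, its coproducts and the dual products\<close>

abbreviation r where "r \<equiv> \<Sum>i<n. tens s V (a i) (b i)"
abbreviation dr where "dr \<equiv> delta_rh s V rh lh r"
abbreviation dl where "dl \<equiv> delta_lh s V rh lh r"

definition flat where "flat u = ext0 V (om u)"

text \<open>Under \<open>V\<^sup>* = V\<close>, the products on \<open>V\<^sup>*\<close> dual to the coproducts given by \<open>r\<close>.\<close>

definition rh_r where "rh_r u v = rh (u - P u) v - rh u (P v)"
definition lh_r where "lh_r u v = lh (u - P u) v - lh u (P v)"

lemma r_product_closed [simp]: "u \<in> V \<Longrightarrow> v \<in> V \<Longrightarrow> rh_r u v \<in> V" "u \<in> V \<Longrightarrow> v \<in> V \<Longrightarrow> lh_r u v \<in> V"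
  by (simp_all add: rh_r_def lh_r_def)

lemma flat_dual [simp]: "u \<in> V \<Longrightarrow> flat u \<in> dual s V"
  by (auto simp: flat_def dual_def ext0_def linear_on_def om_add om_scale)

lemma dual_flatE:
  assumes "\<phi> \<in> dual s V" obtains u where "u \<in> V" "\<phi> = flat u"
  using om_dual[OF assms] by (auto simp: flat_def)

lemma flat_apply [simp]: "v \<in> V \<Longrightarrow> flat u v = om u v"
  by (simp add: flat_def ext0_def)

lemma flat_eqI:
  assumes "u \<in> V" "\<And>x. x \<in> V \<Longrightarrow> \<phi> x = om u x"
  shows "ext0 V \<phi> = flat u"
  using assms by (auto simp: flat_def ext0_def)

lemma r_flat: "u \<in> V \<Longrightarrow> v \<in> V \<Longrightarrow> r (flat u, flat v) = om (P v) u"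
  using P_expand[of u v] by (simp add: sum_apply tens_def ext0_def ab_closed)

text \<open>The transposes of the multiplications under the identification of \<open>V\<close> with
  its dual; the adjoint formulas make each pulled-back covector a \<open>flat\<close> again, so
  \<open>tmap\<close> can be computed on such covectors.\<close>

lemma flat_pull:
  assumes "u \<in> V" "t \<in> V"
  shows "ext0 V (\<lambda>x. flat u (rmul st t x)) = flat (- lh t u)"
    "ext0 V (\<lambda>x. flat u (lmul lh t x)) = flat (- st u t)"
    "ext0 V (\<lambda>x. flat u (rmul rh t x)) = flat (st t u)"
    "ext0 V (\<lambda>x. flat u (lmul st t x)) = flat (rh u t)"
    "ext0 V (\<lambda>x. flat u (rmul lh t x)) = flat (rh t u)"
    "ext0 V (\<lambda>x. flat u (lmul rh t x)) = flat (lh u t)"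
    "ext0 V (\<lambda>x. flat u (id x)) = flat u"
proof -
  have sk: "om u (f x y) = - om (f x y) u"
    if "x \<in> V" "y \<in> V" "f \<in> {rh, lh, st}" for f x y
    using that assms by (intro om_skew) auto
  have sk': "om (f x y) z = - om z (f x y)"
    if "x \<in> V" "y \<in> V" "z \<in> V" "f \<in> {rh, lh, st}" for f x y z
    using that assms by (intro om_skew) auto
  show "ext0 V (\<lambda>x. flat u (rmul st t x)) = flat (- lh t u)"
    using assms by (intro flat_eqI) (simp_all add: rmul_def sk om_star_transfer(1)[of _ t u] om_left sk'[of t u _ lh])
  show "ext0 V (\<lambda>x. flat u (lmul lh t x)) = flat (- st u t)"
    using assms by (intro flat_eqI) (simp_all add: lmul_def sk om_transfer(4)[of t _ u] om_left sk'[of u t _ st])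
  show "ext0 V (\<lambda>x. flat u (rmul rh t x)) = flat (st t u)"
    using assms by (intro flat_eqI) (simp_all add: rmul_def sk om_transfer(1)[of _ t u] om_left sk'[of t u _ st])
  show "ext0 V (\<lambda>x. flat u (lmul st t x)) = flat (rh u t)"
    using assms by (intro flat_eqI) (simp_all add: lmul_def sk om_star_transfer(2)[of t _ u] om_left sk'[of u t _ rh])
  show "ext0 V (\<lambda>x. flat u (rmul lh t x)) = flat (rh t u)"
    using assms by (intro flat_eqI) (simp_all add: rmul_def sk om_transfer(2)[of _ t u] om_left sk'[of t u _ rh])
  show "ext0 V (\<lambda>x. flat u (lmul rh t x)) = flat (lh u t)"
    using assms by (intro flat_eqI) (simp_all add: lmul_def sk om_transfer(3)[of t _ u] om_left sk'[of u t _ lh])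
  show "ext0 V (\<lambda>x. flat u (id x)) = flat u"
    using assms by (intro flat_eqI) simp_all
qed

lemma ext0_flat: "u \<in> V \<Longrightarrow> ext0 V (flat u) = flat u"
  by (intro flat_eqI) simp_all

lemma tmap_flat: "u \<in> V \<Longrightarrow> v \<in> V \<Longrightarrow>
  tmap s V f g t (flat u, flat v) = t (ext0 V (\<lambda>x. flat u (f x)), ext0 V (\<lambda>x. flat v (g x)))"
  by (simp add: tmap_def ext0_def[of "_ \<times> _"])

text \<open>Where the multiplication acts on the second leg of \<open>r\<close>, the adjoint of
  \<open>P\<close> puts \<open>Q\<close> on \<open>u\<close>; where it acts on the first leg,
  \<open>P\<close> stays on \<open>v\<close>. Moving \<open>t\<close> out by
  \<open>om_transfer\<close> then produces the two terms of \<open>rh_r\<close> and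
  \<open>lh_r\<close>.\<close>

lemma delta_flat:
  assumes "u \<in> V" "v \<in> V" "t \<in> V"
  shows "dr t (flat u, flat v) = om (rh_r u v) t" "dl t (flat u, flat v) = om (lh_r u v) t"
proof -
  have "om (P v) (- lh t u) + om (P (- st v t)) u = om (rh_r u v) t"
    using assms om_skew[of "st v t" "u - P u"] om_transfer(1)[of "u - P u" v t] om_transfer(3)[of u "P v" t]
    by (simp add: rh_r_def om_minus om_diff om_P om_left(2,3) P_simps)
  then show "dr t (flat u, flat v) = om (rh_r u v) t"
    using assms by (simp add: delta_rh_def tmap_flat flat_pull ext0_flat r_flat)
  have "om (P v) (st t u) - om (P (rh v t)) u = om (lh_r u v) t"
    using assms om_skew[of "rh v t" "u - P u"] om_transfer(2)[of "u - P u" v t] om_transfer(4)[of u "P v" t]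
    by (simp add: lh_r_def om_minus om_diff om_P om_left(2,3) P_simps)
  then show "dl t (flat u, flat v) = om (lh_r u v) t"
    using assms by (simp add: delta_lh_def tmap_flat flat_pull ext0_flat r_flat)
qed

section \<open>The nine compatibility conditions for the coproducts of \<open>r\<close>\<close>

lemma om_r_product:
  assumes "u \<in> V" "v \<in> V" "t \<in> V"
  shows "om (rh_r u v) t = om (rh u v) t - om (rh (P u) v) t - om (rh u (P v)) t"
    "om (lh_r u v) t = om (lh u v) t - om (lh (P u) v) t - om (lh u (P v)) t"
  using assms by (simp_all add: rh_r_def lh_r_def product_diff om_left)

text \<open>The argument \<open>m\<close> is isolated because it will be a product itself. All terms
  are then pairings of two products, with \<open>P\<close> either on one factor or on a whole
  product. The next lemma does the same for the right factor.\<close>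

lemma om_r_product_left:
  assumes "m \<in> V" "v \<in> V" "t \<in> V"
  shows "om (rh_r m v) t = om m (P (st v t)) - om m (st (P v) t)"
    "om (lh_r m v) t = om m (P (rh v t)) - om m (rh (P v) t)"
  using assms om_P[of m "st v t"] om_P[of m "rh v t"]
  by (simp_all add: om_r_product om_transfer(1,2)[of _ _ t])

lemma om_r_product_right:
  assumes "u \<in> V" "m \<in> V" "t \<in> V"
  shows "om (rh_r u m) t = om m (P (lh t u)) - om m (lh t (P u))"
    "om (lh_r u m) t = om m (st t (P u)) - om m (P (st t u))"
  using assms om_P[of m "lh t u"] om_P[of m "st t u"]
  by (simp_all add: om_r_product om_transfer(3,4)[of _ _ t])

lemma P_star: "u \<in> V \<Longrightarrow> v \<in> V \<Longrightarrow> P (st u v) = P (rh u v) - P (lh u v)"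
  by (simp add: star_def P_simps)

text \<open>Skew-symmetry and the adjoint of \<open>P\<close> reverse a pairing with
  \<open>P\<close> on one side, at the cost of a pairing without \<open>P\<close>.\<close>

lemma om_P_swap: "m \<in> V \<Longrightarrow> m' \<in> V \<Longrightarrow> om m' (P m) = om m (P m') - om m m'"
  using om_skew[of m' "P m"] by (simp add: om_P)

lemma om_star:
  "u \<in> V \<Longrightarrow> v \<in> V \<Longrightarrow> w \<in> V \<Longrightarrow> om (st u v) w = om (rh u v) w - om (lh u v) w"
  "u \<in> V \<Longrightarrow> v \<in> V \<Longrightarrow> w \<in> V \<Longrightarrow> om w (st u v) = om w (rh u v) - om w (lh u v)"
  by (simp_all add: star_def om_linear)

lemmas om_expand = P_star om_star om_diff om_left(2,3)

text \<open>These are the nine conditions evaluated at \<open>flat u\<close> and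
  \<open>flat v\<close>. Each becomes a linear identity between pairings of two products, and these
  are reduced by \<open>om_quad\<close>.\<close>

lemma bi_dialgebra_identities:
  assumes V: "u \<in> V" "v \<in> V" "x \<in> V" "y \<in> V"
  shows "- om (lh_r u (st v x)) y = om (rh_r (st y u) v) x"
    "om (rh_r (st u x) v) y = om (rh_r (st v y) u) x"
    "om (lh_r v (st x u)) y = om (lh_r u (st y v)) x"
    "om (rh_r u v) (rh x y) = om (rh_r u (lh v x)) y + om (rh_r (lh y u) v) x - om (lh_r (lh y u) v) x"
    "om (rh_r u v) (lh x y) = om (lh_r u (st v x)) y - om (rh_r u (st v x)) y + om (rh_r (rh y u) v) x"
    "om (lh_r u v) (rh x y) = om (lh_r u (rh v x)) y + om (lh_r (st y u) v) x"
    "om (lh_r u v) (lh x y) = om (lh_r (rh y u) v) x - om (rh_r u (rh v x)) y + om (lh_r u (rh v x)) y"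
    "om (rh_r (rh u x) v) y - om (lh_r (st v y) u) x =
       om (lh_r v (lh y u)) x - om (rh_r v (lh y u)) x + om (rh_r u (rh x v)) y"
    "om (lh_r v (rh x u)) y + om (rh_r u (st y v)) x - om (lh_r u (st y v)) x =
       om (rh_r (rh u y) v) x - om (lh_r (rh u y) v) x + om (lh_r (lh v x) u) y"
proof -
  \<comment> \<open>The conditions involve three cyclic orders of the arguments:
    \<open>u, v, x, y\<close> for the first and the fourth to seventh, \<open>u, x, v, y\<close> for
    the second and eighth, \<open>u, y, v, x\<close> for the third and ninth. Each order is needed
    without \<open>P\<close>, with \<open>P u\<close> and with \<open>P v\<close>.\<close>
  note q = om_quad[OF V(1,2,3,4)] om_quad[OF P_closed[OF V(1)] V(2,3,4)] om_quad[OF V(1) P_closed[OF V(2)] V(3,4)]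
  note q' = om_quad[OF V(1,3,2,4)] om_quad[OF P_closed[OF V(1)] V(3,2,4)] om_quad[OF V(1,3) P_closed[OF V(2)] V(4)]
  note q'' = om_quad[OF V(1,4,2,3)] om_quad[OF P_closed[OF V(1)] V(4,2,3)] om_quad[OF V(1,4) P_closed[OF V(2)] V(3)]
  \<comment> \<open>The instances of \<open>om_P_swap\<close> bring pairings with \<open>P\<close>
    on a whole product into a fixed order, so that such terms cancel and the pairings of
    \<open>om_quad\<close> are left.\<close>
  note sw = om_r_product_left[of _ v x] om_r_product_right[of u _ y] om_P_swap[of "rh y u" "rh v x"] om_P_swap[of "rh y u" "lh v x"]
    om_P_swap[of "lh y u" "rh v x"] om_P_swap[of "lh y u" "lh v x"]
  note sw' = om_r_product_left[of _ v y] om_r_product_left[of _ u x] om_r_product_right[of v _ x] om_r_product_right[of u _ y]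
    om_P_swap[of "rh u x" "rh v y"] om_P_swap[of "rh u x" "lh v y"]
    om_P_swap[of "lh u x" "rh v y"] om_P_swap[of "lh u x" "lh v y"]
    om_P_swap[of "rh x v" "rh y u"] om_P_swap[of "rh x v" "lh y u"]
    om_P_swap[of "lh x v" "rh y u"] om_P_swap[of "lh x v" "lh y u"]
  note sw'' = om_r_product_left[of _ v x] om_r_product_left[of _ u y] om_r_product_right[of v _ y] om_r_product_right[of u _ x]
    om_P_swap[of "rh u y" "rh v x"] om_P_swap[of "rh u y" "lh v x"]
    om_P_swap[of "lh u y" "rh v x"] om_P_swap[of "lh u y" "lh v x"]
    om_P_swap[of "rh y v" "rh x u"] om_P_swap[of "rh y v" "lh x u"]
    om_P_swap[of "lh y v" "rh x u"] om_P_swap[of "lh y v" "lh x u"]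
  show "- om (lh_r u (st v x)) y = om (rh_r (st y u) v) x"
    using V by (simp add: om_expand sw q)
  show "om (rh_r (st u x) v) y = om (rh_r (st v y) u) x"
    using V by (simp add: om_expand sw' q')
  show "om (lh_r v (st x u)) y = om (lh_r u (st y v)) x"
    using V by (simp add: om_expand sw'' q'')
  show "om (rh_r u v) (rh x y) = om (rh_r u (lh v x)) y + om (rh_r (lh y u) v) x - om (lh_r (lh y u) v) x"
    using V by (simp add: om_r_product[of u v] om_expand sw q)
  show "om (rh_r u v) (lh x y) = om (lh_r u (st v x)) y - om (rh_r u (st v x)) y + om (rh_r (rh y u) v) x"
    using V by (simp add: om_r_product[of u v] om_expand sw q)
  show "om (lh_r u v) (rh x y) = om (lh_r u (rh v x)) y + om (lh_r (st y u) v) x"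
    using V by (simp add: om_r_product[of u v] om_expand sw q)
  show "om (lh_r u v) (lh x y) = om (lh_r (rh y u) v) x - om (rh_r u (rh v x)) y + om (lh_r u (rh v x)) y"
    using V by (simp add: om_r_product[of u v] om_expand sw q)
  show "om (rh_r (rh u x) v) y - om (lh_r (st v y) u) x =
       om (lh_r v (lh y u)) x - om (rh_r v (lh y u)) x + om (rh_r u (rh x v)) y"
    using V by (simp add: om_expand sw' q')
  show "om (lh_r v (rh x u)) y + om (rh_r u (st y v)) x - om (lh_r u (st y v)) x =
       om (rh_r (rh u y) v) x - om (lh_r (rh u y) v) x + om (lh_r (lh v x) u) y"
    using V by (simp add: om_expand sw'' q'')
qed

section \<open>Membership and equality of tensors\<close>

lemma bilin_st: "bilinear_product s V st"
  using bilin_rh bilin_lh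
  by (auto simp: bilinear_product_def star_def lmul_def rmul_def linear_on_def
      scale_right_diff_distrib intro: subspace_diff[OF subspace_V])

lemma r_tensor2: "r \<in> tensor2 s V"
  by (intro tensor2_sum tens_in_tensor2) (simp_all add: ab_closed)

lemma tau_tensor2: "t \<in> tensor2 s V \<Longrightarrow> tau t \<in> tensor2 s V"
  by (auto simp: tensor2_def tau_def)

lemma tmap_mul_tensor2:
  assumes "t \<in> tensor2 s V" "x \<in> V" "m \<in> {rh, lh, st}"
  shows "tmap s V (lmul m x) id t \<in> tensor2 s V" "tmap s V (rmul m x) id t \<in> tensor2 s V"
    "tmap s V id (lmul m x) t \<in> tensor2 s V" "tmap s V id (rmul m x) t \<in> tensor2 s V"
proof -
  have m: "bilinear_product s V m" using assms(3) bilin_rh bilin_lh bilin_st by auto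
  have id: "linear_on s s V id" by (simp add: linear_on_def)
  have l: "linear_on s s V (lmul m x)" "linear_on s s V (rmul m x)"
    "\<And>y. y \<in> V \<Longrightarrow> lmul m x y \<in> V" "\<And>y. y \<in> V \<Longrightarrow> rmul m x y \<in> V"
    using m assms(2) unfolding bilinear_product_def
    by (blast, blast, simp_all add: lmul_def[of m x] rmul_def[of m x])
  show "tmap s V (lmul m x) id t \<in> tensor2 s V" "tmap s V (rmul m x) id t \<in> tensor2 s V"
    "tmap s V id (lmul m x) t \<in> tensor2 s V" "tmap s V id (rmul m x) t \<in> tensor2 s V"
    by (intro tmap_tensor2[OF fd] l id assms(1); simp)+
qed

lemma delta_tensor2: "x \<in> V \<Longrightarrow> dr x \<in> tensor2 s V" "x \<in> V \<Longrightarrow> dl x \<in> tensor2 s V"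
  by (auto simp: delta_rh_def delta_lh_def
      intro!: tensor2_add tensor2_diff tmap_mul_tensor2 r_tensor2)

lemma tensor2_eqI:
  assumes t: "t \<in> tensor2 s V" "t' \<in> tensor2 s V"
    and eq: "\<And>u v. u \<in> V \<Longrightarrow> v \<in> V \<Longrightarrow> t (flat u, flat v) = t' (flat u, flat v)"
  shows "t = t'"
proof (rule ext, clarify)
  fix \<phi> \<psi>
  show "t (\<phi>, \<psi>) = t' (\<phi>, \<psi>)"
  proof (cases "\<phi> \<in> dual s V \<and> \<psi> \<in> dual s V")
    case True
    then show ?thesis by (metis eq dual_flatE)
  qed (use t in \<open>auto simp: tensor2_def\<close>)
qed

lemma ext0_dual3_eqI:
  assumes "\<And>u v w. u \<in> V \<Longrightarrow> v \<in> V \<Longrightarrow> w \<in> V \<Longrightarrow>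
    f (flat u, flat v, flat w) = g (flat u, flat v, flat w)"
  shows "ext0 (dual s V \<times> dual s V \<times> dual s V) f = ext0 (dual s V \<times> dual s V \<times> dual s V) g"
proof (rule ext, clarify)
  fix \<phi> \<psi> \<chi>
  show "ext0 (dual s V \<times> dual s V \<times> dual s V) f (\<phi>, \<psi>, \<chi>) =
    ext0 (dual s V \<times> dual s V \<times> dual s V) g (\<phi>, \<psi>, \<chi>)"
  proof (cases "\<phi> \<in> dual s V \<and> \<psi> \<in> dual s V \<and> \<chi> \<in> dual s V")
    case True
    then obtain u v w where "u \<in> V" "\<phi> = flat u" "v \<in> V" "\<psi> = flat v" "w \<in> V" "\<chi> = flat w"
      by (metis dual_flatE)
    then show ?thesis using assms by (simp add: ext0_def)
  qed (auto simp: ext0_def)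
qed

text \<open>The mixed product of \<open>u - P u\<close> with \<open>P v\<close> occurs in both terms
  of the definition and cancels.\<close>

lemma r_product_split:
  assumes "u \<in> V" "v \<in> V"
  shows "rh_r u v = rh (u - P u) (v - P v) - rh (P u) (P v)"
    "lh_r u v = lh (u - P u) (v - P v) - lh (P u) (P v)"
  using assms by (simp_all add: rh_r_def lh_r_def product_diff)

text \<open>The last two equations give the \<open>Q\<close>-components of the products; subtracting
  the \<open>P\<close>-component, which is a negative, leaves the sums on their left-hand
  sides.\<close>

lemma PQ_product:
  assumes "u \<in> V" "v \<in> V"
  shows "P (rh_r u v) = - rh (P u) (P v)" "P (lh_r u v) = - lh (P u) (P v)"
    "rh_r u v + rh (P u) (P v) = rh (u - P u) (v - P v)"
    "lh_r u v + lh (P u) (P v) = lh (u - P u) (v - P v)"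
proof -
  show "P (rh_r u v) = - rh (P u) (P v)" "P (lh_r u v) = - lh (P u) (P v)"
    unfolding r_product_split[OF assms] using assms by (simp_all add: P_simps P_product Q_product)
  show "rh_r u v + rh (P u) (P v) = rh (u - P u) (v - P v)"
    "lh_r u v + lh (P u) (P v) = lh (u - P u) (v - P v)"
    unfolding r_product_split[OF assms] by simp_all
qed

text \<open>With the products \<open>rh_r\<close> and \<open>lh_r\<close>, the space \<open>V\<close> is the direct sum of the dialgebra \<open>Q V\<close>
  and of the dialgebra \<open>P V\<close> with negated products.\<close>

lemma r_product_assoc:
  assumes "u \<in> V" "v \<in> V" "w \<in> V"
  shows "rh_r (rh_r u v) w = rh_r u (rh_r v w)" "lh_r (lh_r u v) w = lh_r u (lh_r v w)"
    "lh_r u (lh_r v w) = lh_r u (rh_r v w)" "lh_r (rh_r u v) w = rh_r u (lh_r v w)" "rh_r (lh_r u v) w = rh_r (rh_r u v) w"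
  using assms
  by (simp_all add: r_product_split[of "rh_r _ _"] r_product_split[of "lh_r _ _"] r_product_split[of _ "rh_r _ _"]
      r_product_split[of _ "lh_r _ _"] PQ_product product_minus assoc)

text \<open>Evaluated at three covectors \<open>flat\<close>, the two sides of a co-dialgebra axiom
  are iterated products \<open>rh_r\<close> and \<open>lh_r\<close> paired with \<open>x\<close>, so
  the axioms follow from \<open>r_product_assoc\<close>.\<close>

lemma codialg: "codialgebra s V dr dl"
proof -
  have co: "coproduct s V \<delta>"
    if \<delta>: "\<And>x. x \<in> V \<Longrightarrow> \<delta> x \<in> tensor2 s V"
      and fl: "\<And>u v x. u \<in> V \<Longrightarrow> v \<in> V \<Longrightarrow> x \<in> V \<Longrightarrow> \<delta> x (flat u, flat v) = om (f u v) x"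
      and f: "\<And>u v. u \<in> V \<Longrightarrow> v \<in> V \<Longrightarrow> f u v \<in> V" for \<delta> f
    unfolding coproduct_def linear_on_def
  proof (intro conjI ballI allI)
    fix x c assume x: "x \<in> V"
    show "\<delta> x \<in> tensor2 s V" by (rule \<delta>[OF x])
    have "fscale c (\<delta> x) \<in> tensor2 s V"
      using \<delta>[OF x] by (auto simp: tensor2_def linear_on_def fscale_def algebra_simps)
    then show "\<delta> (s c x) = fscale c (\<delta> x)"
      using x by (intro tensor2_eqI \<delta>) (simp_all add: fl f om_scale fscale_def)
    fix y assume y: "y \<in> V"
    show "\<delta> (x + y) = \<delta> x + \<delta> y"
      using x y by (intro tensor2_eqI \<delta> tensor2_add) (simp_all add: fl f om_add)
  qed
  have pull: "ext0 V (\<lambda>x. dr x (flat u, flat v)) = flat (rh_r u v)"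
    "ext0 V (\<lambda>x. dl x (flat u, flat v)) = flat (lh_r u v)" if "u \<in> V" "v \<in> V" for u v
    using that by (auto intro!: flat_eqI simp: delta_flat)
  show ?thesis
    unfolding codialgebra_def cotens1_def cotens2_def
    by (intro conjI ballI ext0_dual3_eqI fd co[of dr rh_r] co[of dl lh_r])
      (simp_all add: delta_tensor2 delta_flat pull r_product_assoc)
qed

lemma r_product_minus:
  assumes "u \<in> V" "v \<in> V"
  shows "rh_r (- u) v = - rh_r u v" "rh_r u (- v) = - rh_r u v" "lh_r (- u) v = - lh_r u v" "lh_r u (- v) = - lh_r u v"
  using assms by (simp_all add: r_product_split P_simps product_minus product_diff)

text \<open>A tensor is determined by its values at pairs of covectors \<open>flat u\<close>,
  \<open>flat v\<close>, so each condition reduces to one scalar identity of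
  \<open>bi_dialgebra_identities\<close>, in the same order.\<close>

lemma bi_dialg: "bi_dialgebra s V rh lh dr dl"
proof -
  note T = tensor2_add tensor2_diff tmap_mul_tensor2 tau_tensor2 delta_tensor2
  have tau_flat: "tau t (p, q) = t (q, p)" for t :: "('b, 'a) tensor2" and p q
    by (simp add: tau_def)
  note S = tmap_flat flat_pull ext0_flat tau_flat delta_flat om_left om_add om_minus
  show ?thesis
    unfolding bi_dialgebra_def Let_def
    apply (intro conjI ballI dialg codialg tensor2_eqI T)
    apply (simp_all add: S r_product_minus)
    subgoal for x y u v using bi_dialgebra_identities(1)[of u v x y] by simp
    subgoal for x y u v using bi_dialgebra_identities(2)[of u v x y] by simp
    subgoal for x y u v using bi_dialgebra_identities(3)[of u v x y] by simp
    subgoal for x y u v using bi_dialgebra_identities(4)[of u v x y] by (simp add: algebra_simps)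
    subgoal for x y u v using bi_dialgebra_identities(5)[of u v x y] by (simp add: algebra_simps)
    subgoal for x y u v using bi_dialgebra_identities(6)[of u v x y] by simp
    subgoal for x y u v using bi_dialgebra_identities(7)[of u v x y] by (simp add: algebra_simps)
    subgoal for x y u v using bi_dialgebra_identities(8)[of u v x y] by (simp add: algebra_simps)
    subgoal for x y u v using bi_dialgebra_identities(9)[of u v x y] by (simp add: algebra_simps)
    done
qed

text \<open>Contracting with three covectors, the first and second terms agree up to a pairing of
  \<open>P w\<close> with the mixed product of \<open>u - P u\<close> and \<open>P v\<close>, and
  the third term supplies exactly that pairing. The image of \<open>Q\<close> being a subalgebra is
  used in the first term, the image of \<open>P\<close> being an isotropic subalgebra in the
  third.\<close>

lemma daybe_r: "daybe s V rh lh r"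
proof -
  have "daybe_sum s V rh lh n a b = 0"
  proof -
    let ?D = "dual s V \<times> dual s V \<times> dual s V"
    note pull = flat_pull[unfolded lmul_def rmul_def]
    have "daybe_sum s V rh lh n a b = ext0 ?D (\<lambda>(u, v, w).
      r (u, ext0 V (\<lambda>x. r (v, ext0 V (\<lambda>y. w (rh x y))))) -
      r (ext0 V (\<lambda>x. r (u, ext0 V (\<lambda>y. v (lh x y)))), w) -
      r (ext0 V (\<lambda>x. r (ext0 V (\<lambda>y. u (st x y)), w)), v))"
      by (rule daybe_sum_eq[OF fd bilin_rh bilin_lh]) (simp_all add: ab_closed)
    also have "\<dots> = ext0 ?D (\<lambda>_. 0)"
    proof (rule ext0_dual3_eqI)
      fix u v w assume V: "u \<in> V" "v \<in> V" "w \<in> V"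
      let ?u = "u - P u" and ?v = "v - P v"
      have 1: "ext0 V (\<lambda>x. r (flat v, ext0 V (\<lambda>y. flat w (rh x y)))) = flat (st ?v w)"
      proof (rule flat_eqI)
        fix x assume x: "x \<in> V"
        show "r (flat v, ext0 V (\<lambda>y. flat w (rh x y))) = om (st ?v w) x"
          using V x om_transfer(4)[of w x ?v] om_skew[of x "st ?v w"]
          by (simp add: pull r_flat om_P om_diff)
      qed (use V in simp)
      have 2: "ext0 V (\<lambda>x. r (flat u, ext0 V (\<lambda>y. flat v (lh x y)))) = flat (rh ?u v)"
      proof (rule flat_eqI)
        fix x assume x: "x \<in> V"
        show "r (flat u, ext0 V (\<lambda>y. flat v (lh x y))) = om (rh ?u v) x"
          using V x om_transfer(1)[of ?u v x] om_skew[of ?u "st v x"]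
          by (simp add: pull r_flat om_P om_diff P_simps om_left(2,3))
      qed (use V in simp)
      have 3: "ext0 V (\<lambda>x. r (ext0 V (\<lambda>y. flat u (st x y)), flat w)) = flat (lh (P w) u)"
      proof (rule flat_eqI)
        fix x assume x: "x \<in> V"
        show "r (ext0 V (\<lambda>y. flat u (st x y)), flat w) = om (lh (P w) u) x"
          using V x om_transfer(3)[of u x "P w"] om_skew[of x "lh (P w) u"] om_skew[of "P w" "rh u x"]
          by (simp add: pull r_flat)
      qed (use V in simp)
      \<comment> \<open>The adjoints move \<open>P\<close> and \<open>st\<close> away from
        \<open>w\<close>. As \<open>P\<close> kills a product of two elements of the image of
        \<open>Q\<close>, \<open>w\<close> may be replaced by \<open>P w\<close>.\<close>
      have "om (P (st ?v w)) u = om (P w) (rh ?u ?v)"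
        using V om_P[of "st ?v w" u] om_diff[of "st ?v w" u "P u"] om_skew[of "st ?v w" ?u]
          om_transfer(1)[of ?u ?v w] om_skew[of w "rh ?u ?v"] om_P[of w "rh ?u ?v"] om_scale[of w 0 0]
        by (simp add: Q_product)
      moreover have "om (P w) (rh ?u v) = om (P w) (rh ?u ?v) + om (P w) (rh ?u (P v))"
        using V by (simp add: om_diff[symmetric] om_add[symmetric] product_add[symmetric])
      \<comment> \<open>This is what allows \<open>u\<close> to be replaced by
        \<open>u - P u\<close> in the third term.\<close>
      moreover have "om (P w) (rh (P u) (P v)) = 0"
        using V P_isotropic[of w "rh (P u) (P v)"] by (simp add: P_product)
      then have "om (P v) (lh (P w) u) = - om (P w) (rh ?u (P v))"
        using V om_transfer(3)[of u "P v" "P w"] om_skew[of "rh u (P v)" "P w"]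
        by (simp add: product_diff om_diff)
      ultimately show "(case (flat u, flat v, flat w) of (u, v, w) \<Rightarrow>
          r (u, ext0 V (\<lambda>x. r (v, ext0 V (\<lambda>y. w (rh x y))))) -
          r (ext0 V (\<lambda>x. r (u, ext0 V (\<lambda>y. v (lh x y)))), w) -
          r (ext0 V (\<lambda>x. r (ext0 V (\<lambda>y. u (st x y)), w)), v)) = 0"
        using V by (simp add: 1 2 3 r_flat)
    qed
    finally show ?thesis by (auto simp: ext0_def)
  qed
  then show ?thesis using ab_closed unfolding daybe_def by blast
qed

section \<open>The skew-symmetric part of \<open>r\<close> and factorizability\<close>

lemma skew_part_flat: "u \<in> V \<Longrightarrow> v \<in> V \<Longrightarrow> (r - tau r) (flat u, flat v) = - om u v"
  using om_skew[of "P v" u] by (simp add: tau_def r_flat om_P)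

text \<open>Since the skew-symmetric part is the negative of \<open>om\<close>, its invariance is
  the invariance of the form, read through the transposes.\<close>

lemma invariant_skew_part: "invariant_tensor s V rh lh (r - tau r)"
proof -
  note T = tensor2_add tensor2_diff tmap_mul_tensor2 tau_tensor2 r_tensor2 tensor2_zero
  show ?thesis
    unfolding invariant_tensor_def
  proof (intro conjI ballI tensor2_eqI T)
    fix x u v assume V: "x \<in> V" "u \<in> V" "v \<in> V"
    show "(tmap s V (rmul st x) id (r - tau r) + tmap s V id (lmul lh x) (r - tau r)) (flat u, flat v) =
      (0 :: ('b, 'a) tensor2) (flat u, flat v)"
      using V om_transfer(1)[of u v x] om_lh[of x u v] unfolding plus_fun_apply
      by (simp add: tmap_flat flat_pull ext0_flat skew_part_flat om_left om_minus del: minus_apply)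
    show "(tmap s V (rmul rh x) id (r - tau r) - tmap s V id (lmul st x) (r - tau r)) (flat u, flat v) =
      (0 :: ('b, 'a) tensor2) (flat u, flat v)"
      using V om_star_transfer(2)[of x u v] unfolding minus_apply[of "tmap _ _ _ _ _"]
      by (simp add: tmap_flat flat_pull ext0_flat skew_part_flat om_left om_minus del: minus_apply)
  qed simp_all
qed

text \<open>The sign of the skew-symmetric part and the sign from exchanging the arguments of
  \<open>om\<close> cancel, so \<open>sharp\<close> is the inverse of \<open>flat\<close>
  itself.\<close>

lemma sharp_flat:
  assumes "u \<in> V" shows "sharp s V (r - tau r) (flat u) = u"
  unfolding sharp_def
proof (rule the_equality)
  show "u \<in> V \<and> (\<forall>\<phi>\<in>dual s V. \<phi> u = (r - tau r) (flat u, \<phi>))"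
  proof (intro conjI ballI assms)
    fix \<phi> assume "\<phi> \<in> dual s V"
    then obtain v where v: "v \<in> V" "\<phi> = flat v" by (rule dual_flatE)
    show "\<phi> u = (r - tau r) (flat u, \<phi>)"
      unfolding v(2) skew_part_flat[OF assms v(1)] flat_apply[OF assms] by (rule om_skew[OF v(1) assms])
  qed
  fix x assume x: "x \<in> V \<and> (\<forall>\<phi>\<in>dual s V. \<phi> x = (r - tau r) (flat u, \<phi>))"
  show "x = u"
  proof (rule om_eqI)
    fix w assume w: "w \<in> V"
    have "flat w x = (r - tau r) (flat u, flat w)" using x w flat_dual by blast
    then have "om w x = - om u w" using x w assms by (simp only: skew_part_flat flat_apply)
    then show "om x w = om u w" using om_skew[of x w] x w by (simp only: minus_minus)
  qed (use x assms in auto)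
qed

theorem factorizable_r: "factorizable s V rh lh r"
proof -
  have flat_add: "flat u + flat v = flat (u + v)" if "u \<in> V" "v \<in> V" for u v
    using that by (auto simp: flat_def ext0_def om_left)
  have flat_scale: "fscale c (flat u) = flat (s c u)" if "u \<in> V" for u c
    using that by (auto simp: flat_def ext0_def om_left fscale_def)
  have "linear_on fscale s (dual s V) (sharp s V (r - tau r))"
    unfolding linear_on_def
    by (auto elim!: dual_flatE simp: flat_add flat_scale sharp_flat)
  moreover have "bij_betw (sharp s V (r - tau r)) (dual s V) V"
    by (rule bij_betw_byWitness[where f' = flat]) (auto elim!: dual_flatE simp: sharp_flat)
  ultimately show ?thesis
    by (simp add: factorizable_def quasi_triangular_def bi_dialg r_tensor2 daybe_r invariant_skew_part)
qed

end

section \<open>The form on the double\<close>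

locale based_bi_dialgebra =
  fixes s :: "'f::field \<Rightarrow> 'a::ab_group_add \<Rightarrow> 'a"
    and A :: "'a set"
    and rh lh :: "'a \<Rightarrow> 'a \<Rightarrow> 'a"
    and dr dl :: "'a \<Rightarrow> ('a, 'f) tensor2"
    and I :: "'i set"
    and e :: "'i \<Rightarrow> 'a"
    and e' :: "'i \<Rightarrow> 'a \<Rightarrow> 'f"
  assumes bi_dialg: "bi_dialgebra s A rh lh dr dl"
    and fin: "finite I"
    and span_e: "module.span s (e ` I) = A"
    and dual_basis: "\<And>i. i \<in> I \<Longrightarrow> e' i \<in> dual s A"
      "\<And>i j. i \<in> I \<Longrightarrow> j \<in> I \<Longrightarrow> e' i (e j) = (if i = j then 1 else 0)"
begin

section \<open>The dialgebra structures of \<open>A\<close> and of its dual\<close>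

abbreviation B where "B \<equiv> dual s A"
abbreviation rb where "rb \<equiv> dual_mult A dr"
abbreviation lb where "lb \<equiv> dual_mult A dl"
abbreviation D where "D \<equiv> double_carrier s A"
abbreviation ds where "ds \<equiv> double_scale s"
abbreviation RH where "RH \<equiv> double_rh s A rh lh dr dl"
abbreviation LH where "LH \<equiv> double_lh s A rh lh dr dl"

lemma dialg: "dialgebra s A rh lh" and codialg: "codialgebra s A dr dl"
  using bi_dialg by (simp_all add: bi_dialgebra_def)

lemma fd: "fd_vector_space s A" and bilin: "bilinear_product s A rh" "bilinear_product s A lh"
  using dialg by (simp_all add: dialgebra_def)

sublocale vector_space s using fd by (simp add: fd_vector_space_def)

lemma subspace_A: "subspace A" using fd by (simp add: fd_vector_space_def)

lemma A_closed [simp]: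
  "x \<in> A \<Longrightarrow> y \<in> A \<Longrightarrow> x + y \<in> A" "x \<in> A \<Longrightarrow> y \<in> A \<Longrightarrow> x - y \<in> A"
  "x \<in> A \<Longrightarrow> - x \<in> A" "x \<in> A \<Longrightarrow> s c x \<in> A" "0 \<in> A"
  "x \<in> A \<Longrightarrow> y \<in> A \<Longrightarrow> rh x y \<in> A" "x \<in> A \<Longrightarrow> y \<in> A \<Longrightarrow> lh x y \<in> A"
  using subspace_A bilin
  by (auto simp: subspace_add subspace_diff subspace_neg subspace_scale subspace_0
      bilinear_product_def)

lemma B_apply:
  assumes "\<phi> \<in> B"
  shows "x \<in> A \<Longrightarrow> y \<in> A \<Longrightarrow> \<phi> (x + y) = \<phi> x + \<phi> y" "x \<in> A \<Longrightarrow> \<phi> (s c x) = c * \<phi> x"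
    "\<phi> 0 = 0" "x \<in> A \<Longrightarrow> \<phi> (- x) = - \<phi> x" "x \<in> A \<Longrightarrow> y \<in> A \<Longrightarrow> \<phi> (x - y) = \<phi> x - \<phi> y"
proof -
  show add: "\<phi> (x + y) = \<phi> x + \<phi> y" if "x \<in> A" "y \<in> A" for x y
    using assms that by (simp add: dual_def linear_on_def)
  show sc: "\<phi> (s c x) = c * \<phi> x" if "x \<in> A" for x c
    using assms that by (simp add: dual_def linear_on_def)
  show "\<phi> 0 = 0" using sc[of 0 0] by simp
  show neg: "\<phi> (- x) = - \<phi> x" if "x \<in> A" for x
    using sc[OF that, of "- 1"] by simp
  show "\<phi> (x - y) = \<phi> x - \<phi> y" if "x \<in> A" "y \<in> A" for x y
    using add[of x "- y"] that by (simp add: neg)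
qed

lemma B_closed [simp]:
  "\<phi> \<in> B \<Longrightarrow> \<psi> \<in> B \<Longrightarrow> \<phi> + \<psi> \<in> B" "\<phi> \<in> B \<Longrightarrow> \<psi> \<in> B \<Longrightarrow> \<phi> - \<psi> \<in> B"
  "\<phi> \<in> B \<Longrightarrow> - \<phi> \<in> B" "\<phi> \<in> B \<Longrightarrow> fscale c \<phi> \<in> B" "0 \<in> B"
  by (auto simp: dual_def linear_on_def fscale_def algebra_simps)

lemma product_linear:
  "x \<in> A \<Longrightarrow> y \<in> A \<Longrightarrow> z \<in> A \<Longrightarrow> rh (x + y) z = rh x z + rh y z"
  "x \<in> A \<Longrightarrow> y \<in> A \<Longrightarrow> z \<in> A \<Longrightarrow> rh x (y + z) = rh x y + rh x z"
  "x \<in> A \<Longrightarrow> y \<in> A \<Longrightarrow> z \<in> A \<Longrightarrow> lh (x + y) z = lh x z + lh y z"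
  "x \<in> A \<Longrightarrow> y \<in> A \<Longrightarrow> z \<in> A \<Longrightarrow> lh x (y + z) = lh x y + lh x z"
  "x \<in> A \<Longrightarrow> y \<in> A \<Longrightarrow> rh (s c x) y = s c (rh x y)"
  "x \<in> A \<Longrightarrow> y \<in> A \<Longrightarrow> rh x (s c y) = s c (rh x y)"
  "x \<in> A \<Longrightarrow> y \<in> A \<Longrightarrow> lh (s c x) y = s c (lh x y)"
  "x \<in> A \<Longrightarrow> y \<in> A \<Longrightarrow> lh x (s c y) = s c (lh x y)"
  using bilin by (auto simp: bilinear_product_def linear_on_def lmul_def rmul_def)

lemma product_zero [simp]:
  "x \<in> A \<Longrightarrow> rh 0 x = 0" "x \<in> A \<Longrightarrow> rh x 0 = 0" "x \<in> A \<Longrightarrow> lh 0 x = 0" "x \<in> A \<Longrightarrow> lh x 0 = 0"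
  using product_linear(5)[of 0 x 0] product_linear(6)[of x 0 0]
    product_linear(7)[of 0 x 0] product_linear(8)[of x 0 0] by simp_all

lemma A_assoc:
  assumes "x \<in> A" "y \<in> A" "z \<in> A"
  shows "rh (rh x y) z = rh x (rh y z)" "lh (lh x y) z = lh x (lh y z)"
    "lh x (rh y z) = lh x (lh y z)" "lh (rh x y) z = rh x (lh y z)" "rh (lh x y) z = rh x (rh y z)"
proof -
  show "rh (rh x y) z = rh x (rh y z)" "lh (rh x y) z = rh x (lh y z)" "rh (lh x y) z = rh x (rh y z)"
    and l: "lh (lh x y) z = lh x (lh y z)"
    using dialg assms unfolding dialgebra_def by blast+
  have "lh (lh x y) z = lh x (rh y z)"
    using dialg assms unfolding dialgebra_def by blast
  then show "lh x (rh y z) = lh x (lh y z)" using l by simp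
qed

lemma coprod: "coproduct s A dr" "coproduct s A dl"
  using codialg by (simp_all add: codialgebra_def)

lemma dual_mult_apply: "x \<in> A \<Longrightarrow> dual_mult A \<delta> a b x = \<delta> x (a, b)"
  by (simp add: dual_mult_def ext0_def)

lemma dual_mult_linear:
  assumes \<delta>: "coproduct s A \<delta>" and B: "a \<in> B" "b \<in> B" "c \<in> B"
  shows "dual_mult A \<delta> a b \<in> B"
    "dual_mult A \<delta> (a + b) c = dual_mult A \<delta> a c + dual_mult A \<delta> b c"
    "dual_mult A \<delta> a (b + c) = dual_mult A \<delta> a b + dual_mult A \<delta> a c"
    "dual_mult A \<delta> (fscale k a) b = fscale k (dual_mult A \<delta> a b)"
    "dual_mult A \<delta> a (fscale k b) = fscale k (dual_mult A \<delta> a b)"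
  using assms
  by (auto simp: coproduct_def tensor2_def linear_on_def dual_mult_def dual_def[of s A] ext0_def
      fscale_def fun_eq_iff)

lemma B_product [simp]: "a \<in> B \<Longrightarrow> b \<in> B \<Longrightarrow> rb a b \<in> B" "a \<in> B \<Longrightarrow> b \<in> B \<Longrightarrow> lb a b \<in> B"
  using dual_mult_linear(1) coprod by blast+

lemma B_product_linear:
  assumes "a \<in> B" "b \<in> B" "c \<in> B"
  shows "rb (a + b) c = rb a c + rb b c" "rb a (b + c) = rb a b + rb a c"
    "rb (fscale k a) b = fscale k (rb a b)" "rb a (fscale k b) = fscale k (rb a b)"
    "lb (a + b) c = lb a c + lb b c" "lb a (b + c) = lb a b + lb a c"
    "lb (fscale k a) b = fscale k (lb a b)" "lb a (fscale k b) = fscale k (lb a b)"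
  using dual_mult_linear(2-)[OF coprod(1) assms] dual_mult_linear(2-)[OF coprod(2) assms] by simp_all

lemma fscale_simps [simp]: "fscale 0 \<phi> = 0" "fscale c 0 = (0 :: 'x \<Rightarrow> 'f)" "fscale (- 1) \<phi> = - \<phi>" for \<phi> :: "'x \<Rightarrow> 'f"
  by (auto simp: fscale_def)

lemma B_product_minus:
  assumes "a \<in> B" "b \<in> B"
  shows "rb (- a) b = - rb a b" "rb a (- b) = - rb a b" "lb (- a) b = - lb a b" "lb a (- b) = - lb a b"
  using B_product_linear(3,4,7,8)[OF assms assms(2), of "- 1"] by simp_all

lemma B_product_zero [simp]:
  assumes "a \<in> B" shows "rb 0 a = 0" "rb a 0 = 0" "lb 0 a = 0" "lb a 0 = 0"
  using B_product_linear(3,7)[OF B_closed(5) assms assms, of 0]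
    B_product_linear(4,8)[OF assms B_closed(5) assms, of 0] by simp_all

lemma B_product_diff:
  assumes "a \<in> B" "b \<in> B" "c \<in> B"
  shows "rb (a - b) c = rb a c - rb b c" "rb a (b - c) = rb a b - rb a c"
    "lb (a - b) c = lb a c - lb b c" "lb a (b - c) = lb a b - lb a c"
  using B_product_linear(1,5)[of a "- b" c] B_product_linear(2,6)[of a b "- c"] assms
  by (simp_all add: B_product_minus)

lemma B_eqI: "\<phi> \<in> B \<Longrightarrow> \<psi> \<in> B \<Longrightarrow> (\<And>x. x \<in> A \<Longrightarrow> \<phi> x = \<psi> x) \<Longrightarrow> \<phi> = \<psi>"
proof
  fix x assume "\<phi> \<in> B" "\<psi> \<in> B" "\<And>x. x \<in> A \<Longrightarrow> \<phi> x = \<psi> x"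
  then show "\<phi> x = \<psi> x" by (cases "x \<in> A") (auto simp: dual_def)
qed

text \<open>Evaluated at three covectors, \<open>cotens1\<close> and \<open>cotens2\<close> are the
  two bracketings of the dual products, so the co-dialgebra axioms of \<open>A\<close> transpose to
  dialgebra axioms on \<open>B\<close>.\<close>

lemma B_assoc:
  assumes "a \<in> B" "b \<in> B" "c \<in> B"
  shows "rb (rb a b) c = rb a (rb b c)" "lb (lb a b) c = lb a (lb b c)"
    "lb a (rb b c) = lb a (lb b c)" "lb (rb a b) c = rb a (lb b c)" "rb (lb a b) c = rb a (rb b c)"
proof -
  have co: "cotens1 s A dr (dr x) = cotens2 s A dr (dr x)"
    "cotens1 s A dl (dl x) = cotens2 s A dl (dl x)"
    "cotens2 s A dl (dl x) = cotens2 s A dr (dl x)"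
    "cotens1 s A dr (dl x) = cotens2 s A dl (dr x)"
    "cotens1 s A dl (dr x) = cotens1 s A dr (dr x)" if "x \<in> A" for x
    using codialg that unfolding codialgebra_def by blast+
  have c: "cotens1 s A \<delta> (\<delta>' x) (a, b, c) = dual_mult A \<delta>' (dual_mult A \<delta> a b) c x"
    "cotens2 s A \<delta> (\<delta>' x) (a, b, c) = dual_mult A \<delta>' a (dual_mult A \<delta> b c) x"
    if "x \<in> A" for \<delta> \<delta>' x
    using assms that by (simp_all add: cotens1_def cotens2_def dual_mult_def ext0_def)
  show "rb (rb a b) c = rb a (rb b c)"
    by (rule B_eqI) (use assms co(1) in \<open>simp_all flip: c\<close>)
  show "lb (lb a b) c = lb a (lb b c)"
    by (rule B_eqI) (use assms co(2) in \<open>simp_all flip: c\<close>)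
  show "lb a (rb b c) = lb a (lb b c)"
    by (rule B_eqI) (use assms co(3) in \<open>simp_all flip: c\<close>)
  show "lb (rb a b) c = rb a (lb b c)"
    by (rule B_eqI) (use assms co(4) in \<open>simp_all flip: c\<close>)
  have "rb (lb a b) c = rb (rb a b) c"
    by (rule B_eqI) (use assms co(5) in \<open>simp_all flip: c\<close>)
  then show "rb (lb a b) c = rb a (rb b c)" using \<open>rb (rb a b) c = rb a (rb b c)\<close> by simp
qed

section \<open>Dual bases, reflexivity and transposes\<close>

lemma e_in_A: "i \<in> I \<Longrightarrow> e i \<in> A"
  using span_e span_base[of "e i" "e ` I"] by auto

lemma A_expand:
  assumes "x \<in> A" shows "x = (\<Sum>i\<in>I. s (e' i x) (e i))"
proof -
  have e'0: "e' i 0 = 0" if "i \<in> I" for i using B_apply(3)[OF dual_basis(1)[OF that]] .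
  have "x \<in> span (e ` I)" using assms span_e by simp
  then have "x \<in> A \<and> x = (\<Sum>i\<in>I. s (e' i x) (e i))"
  proof (induction rule: span_induct_alt)
    case base
    show ?case by (simp add: e'0)
  next
    case (step c x y)
    then obtain j where j: "j \<in> I" "x = e j" by auto
    have "(\<Sum>i\<in>I. s (e' i (s c x + y)) (e i)) =
        (\<Sum>i\<in>I. s c (if i = j then e i else 0) + s (e' i y) (e i))"
      using j step by (intro sum.cong refl)
        (simp add: B_apply[OF dual_basis(1)] e_in_A dual_basis(2) scale_left_distrib)
    also have "\<dots> = s c x + (\<Sum>i\<in>I. s (e' i y) (e i))"
      using j fin by (simp add: sum.distrib flip: scale_sum_right)
    finally show ?case using step j by (simp add: e_in_A)
  qed
  then show ?thesis ..
qed

lemma dual_expand_B: "\<phi> \<in> B \<Longrightarrow> \<phi> = (\<Sum>i\<in>I. fscale (\<phi> (e i)) (e' i))"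
  by (rule dual_expand[OF vector_space_axioms fin span_e dual_basis])

lemma B_separates:
  assumes "x \<in> A" "y \<in> A" "\<And>\<phi>. \<phi> \<in> B \<Longrightarrow> \<phi> x = \<phi> y"
  shows "x = y"
proof -
  have "(\<Sum>i\<in>I. s (e' i x) (e i)) = (\<Sum>i\<in>I. s (e' i y) (e i))"
    by (intro sum.cong refl) (simp add: assms(3) dual_basis(1))
  then show ?thesis using A_expand[OF assms(1)] A_expand[OF assms(2)] by simp
qed

text \<open>Reflexivity of \<open>A\<close>: the vector representing \<open>\<Phi>\<close> has the
  values of \<open>\<Phi>\<close> on the dual basis as its coordinates.\<close>

lemma bidual:
  assumes "linear_on fscale (*) B \<Phi>"
  shows "\<exists>x\<in>A. \<forall>\<phi>\<in>B. \<phi> x = \<Phi> \<phi>"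
proof
  let ?x = "\<Sum>i\<in>I. s (\<Phi> (e' i)) (e i)"
  show "?x \<in> A" by (intro subspace_sum[OF subspace_A]) (simp add: e_in_A)
  have z: "\<Phi> 0 = 0"
  proof -
    have "\<Phi> (fscale 0 0) = 0 * \<Phi> 0"
      using assms B_closed(5) unfolding linear_on_def by blast
    then show ?thesis by simp
  qed
  show "\<forall>\<phi>\<in>B. \<phi> ?x = \<Phi> \<phi>"
  proof
    fix \<phi> assume \<phi>: "\<phi> \<in> B"
    have "\<phi> ?x = (\<Sum>i\<in>I. \<Phi> (e' i) * \<phi> (e i))"
      using linear_on_sum[of s "(*)" A \<phi> I e "\<lambda>i. \<Phi> (e' i)"] \<phi> B_apply[OF \<phi>]
      by (simp add: linear_on_def e_in_A)
    also have "\<dots> = \<Phi> (\<Sum>i\<in>I. fscale (\<phi> (e i)) (e' i))"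
      using linear_on_sum[of fscale "(*)" B \<Phi> I e' "\<lambda>i. \<phi> (e i)"] assms z
      by (simp add: dual_basis(1) mult.commute)
    finally show "\<phi> ?x = \<Phi> \<phi>" using dual_expand_B[OF \<phi>] by simp
  qed
qed

text \<open>The description in \<open>un_ev\<close> denotes: \<open>bidual\<close> gives existence
  and \<open>B_separates\<close> uniqueness. Afterwards such vectors are known through their
  pairings with covectors.\<close>

lemma contra_dual:
  assumes x: "x \<in> A" and f: "linear_on fscale fscale B f" "\<And>\<phi>. \<phi> \<in> B \<Longrightarrow> f \<phi> \<in> B"
  shows "contra_dual s A f x \<in> A" "\<phi> \<in> B \<Longrightarrow> \<phi> (contra_dual s A f x) = - f \<phi> x"
proof -
  let ?\<Phi> = "contra B f (ev s A x)"
  have \<Phi>: "?\<Phi> \<phi> = - f \<phi> x" if "\<phi> \<in> B" for \<phi>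
    using that f(2) by (simp add: contra_def ev_def ext0_def)
  have "linear_on fscale (*) B ?\<Phi>"
    using f(1) by (simp add: linear_on_def \<Phi>) (simp add: fscale_def)
  then obtain y where y: "y \<in> A" "\<And>\<phi>. \<phi> \<in> B \<Longrightarrow> \<phi> y = ?\<Phi> \<phi>"
    using bidual by blast
  have ev: "ev s A y = ?\<Phi>"
    using y(2) by (auto simp: ev_def contra_def ext0_def)
  have "contra_dual s A f x = y"
    unfolding contra_dual_def un_ev_def
  proof (rule the_equality)
    show "y \<in> A \<and> ev s A y = ?\<Phi>" using y(1) ev by simp
    fix z assume z: "z \<in> A \<and> ev s A z = ?\<Phi>"
    have "\<phi> z = \<phi> y" if "\<phi> \<in> B" for \<phi>
    proof -
      have "ev s A z \<phi> = ev s A y \<phi>" using z ev by simp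
      then show ?thesis using that by (simp add: ev_def ext0_def)
    qed
    then show "z = y" using z y(1) by (auto intro: B_separates)
  qed
  then show "contra_dual s A f x \<in> A" "\<phi> \<in> B \<Longrightarrow> \<phi> (contra_dual s A f x) = - f \<phi> x"
    using y \<Phi> by auto
qed

text \<open>Transposes: \<open>\<langle>cR m x a, z\<rangle> = \<langle>a, m z x\<rangle>\<close>, \<open>\<langle>cL m x a, z\<rangle> = \<langle>a, m x z\<rangle>\<close>,
  \<open>\<langle>\<phi>, vR m a x\<rangle> = \<langle>m \<phi> a, x\<rangle>\<close> and \<open>\<langle>\<phi>, vL m a x\<rangle> = \<langle>m a \<phi>, x\<rangle>\<close>.\<close>

definition cR where "cR m x a = ext0 A (\<lambda>z. a (m z x))"
definition cL where "cL m x a = ext0 A (\<lambda>z. a (m x z))"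
definition vR where "vR m a x = - contra_dual s A (rmul m a) x"
definition vL where "vL m a x = - contra_dual s A (lmul m a) x"

lemma covector_apply: "z \<in> A \<Longrightarrow> cR m x a z = a (m z x)" "z \<in> A \<Longrightarrow> cL m x a z = a (m x z)"
  by (simp_all add: cR_def cL_def ext0_def)

lemma covector_closed [simp]:
  "x \<in> A \<Longrightarrow> a \<in> B \<Longrightarrow> cR rh x a \<in> B" "x \<in> A \<Longrightarrow> a \<in> B \<Longrightarrow> cR lh x a \<in> B"
  "x \<in> A \<Longrightarrow> a \<in> B \<Longrightarrow> cL rh x a \<in> B" "x \<in> A \<Longrightarrow> a \<in> B \<Longrightarrow> cL lh x a \<in> B"
  by (auto simp: dual_def[of s A] linear_on_def cR_def cL_def ext0_def product_linear)

lemma dual_mul_linear: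
  assumes "b \<in> B" "m \<in> {rb, lb}"
  shows "linear_on fscale fscale B (lmul m b)" "linear_on fscale fscale B (rmul m b)"
    "\<phi> \<in> B \<Longrightarrow> lmul m b \<phi> \<in> B" "\<phi> \<in> B \<Longrightarrow> rmul m b \<phi> \<in> B"
  using assms by (auto simp: linear_on_def lmul_def rmul_def B_product_linear)

lemma vector_closed [simp]:
  "a \<in> B \<Longrightarrow> x \<in> A \<Longrightarrow> vR rb a x \<in> A" "a \<in> B \<Longrightarrow> x \<in> A \<Longrightarrow> vR lb a x \<in> A"
  "a \<in> B \<Longrightarrow> x \<in> A \<Longrightarrow> vL rb a x \<in> A" "a \<in> B \<Longrightarrow> x \<in> A \<Longrightarrow> vL lb a x \<in> A"
  by (simp_all add: vR_def vL_def contra_dual(1) dual_mul_linear)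

lemma vector_apply [simp]:
  assumes "a \<in> B" "x \<in> A" "\<phi> \<in> B"
  shows "\<phi> (vR rb a x) = rb \<phi> a x" "\<phi> (vR lb a x) = lb \<phi> a x"
    "\<phi> (vL rb a x) = rb a \<phi> x" "\<phi> (vL lb a x) = lb a \<phi> x"
proof -
  have "\<phi> (vR m a x) = m \<phi> a x" "\<phi> (vL m a x) = m a \<phi> x" if "m \<in> {rb, lb}" for m
  proof -
    note R = contra_dual[OF assms(2) dual_mul_linear(2,4)[OF assms(1) that]]
    note L = contra_dual[OF assms(2) dual_mul_linear(1,3)[OF assms(1) that]]
    show "\<phi> (vR m a x) = m \<phi> a x"
      using R(2)[OF _ assms(3)] B_apply(4)[OF assms(3) R(1)] by (simp add: vR_def) (simp add: rmul_def)
    show "\<phi> (vL m a x) = m a \<phi> x"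
      using L(2)[OF _ assms(3)] B_apply(4)[OF assms(3) L(1)] by (simp add: vL_def) (simp add: lmul_def)
  qed
  then show "\<phi> (vR rb a x) = rb \<phi> a x" "\<phi> (vR lb a x) = lb \<phi> a x"
    "\<phi> (vL rb a x) = rb a \<phi> x" "\<phi> (vL lb a x) = lb a \<phi> x" by blast+
qed

lemma star_linear: "b \<in> B \<Longrightarrow> linear_on fscale fscale B (lmul (star rb lb) b)"
  "b \<in> B \<Longrightarrow> linear_on fscale fscale B (rmul (star rb lb) b)"
proof -
  have "fscale c (f - g) = fscale c f - fscale c g" for c and f g :: "'a \<Rightarrow> 'f"
    by (auto simp: fscale_def algebra_simps)
  then show "b \<in> B \<Longrightarrow> linear_on fscale fscale B (lmul (star rb lb) b)"
    "b \<in> B \<Longrightarrow> linear_on fscale fscale B (rmul (star rb lb) b)"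
    by (auto simp: linear_on_def lmul_def rmul_def star_def B_product_linear)
qed

lemma contra_dual_star:
  assumes "a \<in> B" "x \<in> A"
  shows "contra_dual s A (lmul (star rb lb) a) x = vL lb a x - vL rb a x"
    "contra_dual s A (rmul (star rb lb) a) x = vR lb a x - vR rb a x"
proof -
  have c: "lmul (star rb lb) a \<phi> \<in> B" "rmul (star rb lb) a \<phi> \<in> B" if "\<phi> \<in> B" for \<phi>
    using that assms by (simp_all add: star_def lmul_def rmul_def)
  note l = contra_dual[OF assms(2) star_linear(1)[OF assms(1)] c(1)]
    contra_dual[OF assms(2) star_linear(2)[OF assms(1)] c(2)]
  show "contra_dual s A (lmul (star rb lb) a) x = vL lb a x - vL rb a x"
    "contra_dual s A (rmul (star rb lb) a) x = vR lb a x - vR rb a x"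
    using assms
    by (auto intro!: B_separates simp: l B_apply)
      (simp_all add: lmul_def rmul_def star_def)
qed

text \<open>The transposes absorb the signs of the contragredient operators, and each operator for
  \<open>star\<close> is split into its two parts.\<close>

lemma RH_eq:
  assumes "x \<in> A" "y \<in> A" "a \<in> B" "b \<in> B"
  shows "RH (x, a) (y, b) = (rh x y + vR lb a y + (vL rb b x - vL lb b x),
    cR lh x b + (cL rh y a - cL lh y a) + rb a b)"
proof -
  have "- contra A (rmul lh x) b - contra A (lmul (star rh lh) y) a = cR lh x b + (cL rh y a - cL lh y a)"
    using assms by (auto simp: fun_eq_iff contra_def cR_def cL_def ext0_def lmul_def rmul_def star_def B_apply)
  then show ?thesis
    using assms by (simp add: double_rh_def Let_def contra_dual_star vR_def algebra_simps)
qed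

lemma LH_eq:
  assumes "x \<in> A" "y \<in> A" "a \<in> B" "b \<in> B"
  shows "LH (x, a) (y, b) = (lh x y + (vR lb a y - vR rb a y) + vL rb b x,
    (cR lh x b - cR rh x b) + cL rh y a + lb a b)"
proof -
  have "contra A (rmul (star rh lh) x) b - contra A (lmul rh y) a = (cR lh x b - cR rh x b) + cL rh y a"
    using assms by (auto simp: fun_eq_iff contra_def cR_def cL_def ext0_def lmul_def rmul_def star_def B_apply)
  then show ?thesis
    using assms by (simp add: double_lh_def Let_def contra_dual_star vL_def algebra_simps)
qed

section \<open>The double as a vector space with bilinear products and invariant pairing\<close>

definition om :: "'a \<times> ('a \<Rightarrow> 'f) \<Rightarrow> 'a \<times> ('a \<Rightarrow> 'f) \<Rightarrow> 'f" where
  "om u v = snd u (fst v) - snd v (fst u)"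

lemma om_pair [simp]: "om (x, a) (y, b) = a y - b x"
  by (simp add: om_def)

lemma D_iff [simp]: "(x, a) \<in> D \<longleftrightarrow> x \<in> A \<and> a \<in> B"
  by (simp add: double_carrier_def)

lemma ds_pair [simp]: "ds c (x, a) = (s c x, fscale c a)"
  by (simp add: double_scale_def)

lemma D_eqI:
  assumes "x \<in> A" "y \<in> A" "a \<in> B" "b \<in> B"
    "\<And>\<phi>. \<phi> \<in> B \<Longrightarrow> \<phi> x = \<phi> y" "\<And>z. z \<in> A \<Longrightarrow> a z = b z"
  shows "(x, a) = (y, b)"
  using assms by (auto intro: B_separates B_eqI)

lemma vector_space_double: "vector_space ds"
  by unfold_locales (auto simp: fscale_def plus_fun_def algebra_simps)

interpretation dbl: vector_space ds by (rule vector_space_double)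

lemma subspace_D: "dbl.subspace D"
  by (auto simp: dbl.subspace_def zero_prod_def)

lemma fd_double: "fd_vector_space ds D"
  unfolding fd_vector_space_def
proof (intro conjI exI)
  let ?G = "(\<lambda>i. (e i, 0)) ` I \<union> (\<lambda>i. (0, e' i)) ` I"
  show "finite ?G" using fin by simp
  show G: "?G \<subseteq> D" using e_in_A dual_basis(1) by auto
  show "dbl.span ?G = D"
  proof
    show "dbl.span ?G \<subseteq> D" by (rule dbl.span_minimal[OF G subspace_D])
    show "D \<subseteq> dbl.span ?G"
    proof clarify
      fix x a assume "(x, a) \<in> D"
      then have xa: "x \<in> A" "a \<in> B" by simp_all
      have "(x, a) = (\<Sum>i\<in>I. ds (e' i x) (e i, 0)) + (\<Sum>i\<in>I. ds (a (e i)) (0, e' i))"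
        using A_expand[OF xa(1)] dual_expand_B[OF xa(2)]
        by (simp add: prod_eq_iff fst_sum snd_sum)
      also have "\<dots> \<in> dbl.span ?G"
        by (intro dbl.span_add dbl.span_sum dbl.span_scale dbl.span_base) auto
      finally show "(x, a) \<in> dbl.span ?G" .
    qed
  qed
qed (rule vector_space_double subspace_D)+

text \<open>The conditions are evaluated at the covectors \<open>a\<close> and \<open>b\<close>.
  Operators on the legs become transposes acting on the covectors, and all star products are
  expanded, so that the conditions can serve as polynomial relations between scalars.\<close>

lemma compat:
  assumes A: "x \<in> A" "y \<in> A" and B: "a \<in> B" "b \<in> B"
  shows "lb a (cL lh x b) y = rb (cR rh y a) b x"
    "rb (cL lh x a) b y = rb (cL lh y b) a x"
    "lb b (cR rh x a) y = lb a (cR rh y b) x"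
    "rb a b (rh x y) = rb a (cL rh x b) y - rb (cR rh y a) b x + rb (cR lh y a) b x
       + lb (cR rh y a) b x - lb (cR lh y a) b x"
    "rb a b (lh x y) = rb a (cL lh x b) y - lb a (cL lh x b) y + rb (cR lh y a) b x"
    "lb a b (rh x y) = lb a (cL rh x b) y - lb a (cL lh x b) y + lb (cR rh y a) b x"
    "lb a b (lh x y) = lb (cR lh y a) b x - rb a (cL rh x b) y + rb a (cL lh x b) y
       + lb a (cL rh x b) y - lb a (cL lh x b) y"
    "rb (cL rh x a) b y - rb (cL lh x a) b y + lb (cL lh y b) a x =
       rb b (cR rh y a) x - rb b (cR lh y a) x - lb b (cR rh y a) x + lb b (cR lh y a) x
       + rb a (cR lh x b) y"
    "lb b (cR lh x a) y + rb a (cR rh y b) x - lb a (cR rh y b) x =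
       rb (cL rh y a) b x - rb (cL lh y a) b x - lb (cL rh y a) b x + lb (cL lh y a) b x
       + lb (cL rh x b) a y"
proof -
  note C = conjunct2[OF conjunct2[OF bi_dialg[unfolded bi_dialgebra_def Let_def]], rule_format, OF A]
  have mul: "tmap s A (rmul m z) id t (a, b) = t (cR m z a, b)"
    "tmap s A (lmul m z) id t (a, b) = t (cL m z a, b)"
    "tmap s A id (rmul m z) t (a, b) = t (a, cR m z b)"
    "tmap s A id (lmul m z) t (a, b) = t (a, cL m z b)" for m z t
  proof -
    have "ext0 A a = a" "ext0 A b = b" using B by (auto simp: ext0_def dual_def)
    then show "tmap s A (rmul m z) id t (a, b) = t (cR m z a, b)"
      "tmap s A (lmul m z) id t (a, b) = t (cL m z a, b)"
      "tmap s A id (rmul m z) t (a, b) = t (a, cR m z b)"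
      "tmap s A id (lmul m z) t (a, b) = t (a, cL m z b)"
      using B by (simp_all add: tmap_def ext0_def[of "_ \<times> _"] cR_def cL_def rmul_def lmul_def)
  qed
  have star: "cR (star rh lh) z f = cR rh z f - cR lh z f" "cL (star rh lh) z f = cL rh z f - cL lh z f"
    if "z \<in> A" "f \<in> B" for z f
    using that by (auto simp: cR_def cL_def star_def ext0_def B_apply)
  have co: "dr z (f, g) = rb f g z" "dl z (f, g) = lb f g z" if "z \<in> A" for z f g
    using that by (simp_all add: dual_mult_apply)
  have tau: "tau t (f, g) = t (g, f)" for t :: "('a, 'f) tensor2" and f g
    by (simp add: tau_def)
  note S = mul star co tau B_product_diff A B
  note C1 = conjunct1[OF C, THEN fun_cong, of "(a, b)"] note R1 = conjunct2[OF C]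
  note C2 = conjunct1[OF R1, THEN fun_cong, of "(a, b)"] note R2 = conjunct2[OF R1]
  note C3 = conjunct1[OF R2, THEN fun_cong, of "(a, b)"] note R3 = conjunct2[OF R2]
  note C4 = conjunct1[OF R3, THEN fun_cong, of "(a, b)"] note R4 = conjunct2[OF R3]
  note C5 = conjunct1[OF R4, THEN fun_cong, of "(a, b)"] note R5 = conjunct2[OF R4]
  note C6 = conjunct1[OF R5, THEN fun_cong, of "(a, b)"] note R6 = conjunct2[OF R5]
  note C7 = conjunct1[OF R6, THEN fun_cong, of "(a, b)"] note R7 = conjunct2[OF R6]
  note C8 = conjunct1[OF R7, THEN fun_cong, of "(a, b)"]
  note C9 = conjunct2[OF R7, THEN fun_cong, of "(a, b)"]
  show "lb a (cL lh x b) y = rb (cR rh y a) b x" using C1 by (simp add: S)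
  show "rb (cL lh x a) b y = rb (cL lh y b) a x" using C2 by (simp add: S)
  show "lb b (cR rh x a) y = lb a (cR rh y b) x" using C3 by (simp add: S)
  show "rb a b (rh x y) = rb a (cL rh x b) y - rb (cR rh y a) b x + rb (cR lh y a) b x
       + lb (cR rh y a) b x - lb (cR lh y a) b x" using C4 by (simp add: S)
  show "rb a b (lh x y) = rb a (cL lh x b) y - lb a (cL lh x b) y + rb (cR lh y a) b x"
    using C5 by (simp add: S)
  show "lb a b (rh x y) = lb a (cL rh x b) y - lb a (cL lh x b) y + lb (cR rh y a) b x"
    using C6 by (simp add: S)
  show "lb a b (lh x y) = lb (cR lh y a) b x - rb a (cL rh x b) y + rb a (cL lh x b) y
       + lb a (cL rh x b) y - lb a (cL lh x b) y" using C7 by (simp add: S)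
  show "rb (cL rh x a) b y - rb (cL lh x a) b y + lb (cL lh y b) a x =
       rb b (cR rh y a) x - rb b (cR lh y a) x - lb b (cR rh y a) x + lb b (cR lh y a) x
       + rb a (cR lh x b) y" using C8 by (simp add: S algebra_simps)
  show "lb b (cR lh x a) y + rb a (cR rh y b) x - lb a (cR rh y b) x =
       rb (cL rh y a) b x - rb (cL lh y a) b x - lb (cL rh y a) b x + lb (cL lh y a) b x
       + lb (cL rh x b) a y" using C9 by (simp add: S algebra_simps)
qed

lemma transpose_zero [simp]:
  "cR m x 0 = 0" "cL m x 0 = 0"
  "a \<in> B \<Longrightarrow> cR rh 0 a = 0" "a \<in> B \<Longrightarrow> cR lh 0 a = 0" "a \<in> B \<Longrightarrow> cL rh 0 a = 0" "a \<in> B \<Longrightarrow> cL lh 0 a = 0"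
  "x \<in> A \<Longrightarrow> vR rb 0 x = 0" "x \<in> A \<Longrightarrow> vR lb 0 x = 0" "x \<in> A \<Longrightarrow> vL rb 0 x = 0" "x \<in> A \<Longrightarrow> vL lb 0 x = 0"
  "a \<in> B \<Longrightarrow> vR rb a 0 = 0" "a \<in> B \<Longrightarrow> vR lb a 0 = 0" "a \<in> B \<Longrightarrow> vL rb a 0 = 0" "a \<in> B \<Longrightarrow> vL lb a 0 = 0"
  by (auto simp: cR_def cL_def ext0_def B_apply intro!: B_separates)

text \<open>The components are tested against covectors and vectors because the contragredient terms
  have no explicit formula, only these pairings.\<close>

lemma product_pair_apply:
  assumes "x \<in> A" "y \<in> A" "a \<in> B" "b \<in> B"
  shows "RH (x, a) (y, b) \<in> D" "LH (x, a) (y, b) \<in> D"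
    "\<phi> \<in> B \<Longrightarrow> \<phi> (fst (RH (x, a) (y, b))) = \<phi> (rh x y) + lb \<phi> a y + rb b \<phi> x - lb b \<phi> x"
    "\<phi> \<in> B \<Longrightarrow> \<phi> (fst (LH (x, a) (y, b))) = \<phi> (lh x y) + lb \<phi> a y - rb \<phi> a y + rb b \<phi> x"
    "z \<in> A \<Longrightarrow> snd (RH (x, a) (y, b)) z = b (lh z x) + a (rh y z) - a (lh y z) + rb a b z"
    "z \<in> A \<Longrightarrow> snd (LH (x, a) (y, b)) z = b (lh z x) - b (rh z x) + a (rh y z) + lb a b z"
  using assms by (simp_all add: RH_eq LH_eq B_apply covector_apply)

lemma product_pair_linear:
  assumes A: "x \<in> A" "x' \<in> A" "y \<in> A" and B: "a \<in> B" "a' \<in> B" "b \<in> B"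
    and m: "m \<in> {RH, LH}"
  shows "m (x + x', a + a') (y, b) = m (x, a) (y, b) + m (x', a') (y, b)"
    "m (y, b) (x + x', a + a') = m (y, b) (x, a) + m (y, b) (x', a')"
    "m (s c x, fscale c a) (y, b) = ds c (m (x, a) (y, b))"
    "m (y, b) (s c x, fscale c a) = ds c (m (y, b) (x, a))"
proof -
  have eqI: "p = q" if "p \<in> D" "q \<in> D" "\<And>\<phi>. \<phi> \<in> B \<Longrightarrow> \<phi> (fst p) = \<phi> (fst q)"
    "\<And>z. z \<in> A \<Longrightarrow> snd p z = snd q z" for p q
    using that D_eqI[of "fst p" "fst q" "snd p" "snd q"] by (cases p, cases q) auto
  have D: "p + q \<in> D" if "p \<in> D" "q \<in> D" for p q
    using that by (cases p, cases q) simp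
  have Ds: "ds c p \<in> D" if "p \<in> D" for p
    using that by (cases p) simp
  have D': "fst p \<in> A" if "p \<in> D" for p using that by (cases p) simp
  have scale: "snd (ds c p) z = c * snd p z" "fst (ds c p) = s c (fst p)" for p z
    by (cases p; simp add: fscale_def)+
  have fs: "fscale c f z = c * f z" for f and z :: 'a by (simp add: fscale_def)
  note lin = product_pair_apply B_product_linear product_linear B_apply scale fs algebra_simps
  show "m (x + x', a + a') (y, b) = m (x, a) (y, b) + m (x', a') (y, b)"
    using m by (rule insertE) (use A B in \<open>auto intro!: eqI D Ds simp: lin D'\<close>)
  show "m (y, b) (x + x', a + a') = m (y, b) (x, a) + m (y, b) (x', a')"
    using m by (rule insertE) (use A B in \<open>auto intro!: eqI D Ds simp: lin D'\<close>)
  show "m (s c x, fscale c a) (y, b) = ds c (m (x, a) (y, b))"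
    using m by (rule insertE) (use A B in \<open>auto intro!: eqI D Ds simp: lin D'\<close>)
  show "m (y, b) (s c x, fscale c a) = ds c (m (y, b) (x, a))"
    using m by (rule insertE) (use A B in \<open>auto intro!: eqI D Ds simp: lin D'\<close>)
qed

lemma bilinear_double: "bilinear_product ds D RH" "bilinear_product ds D LH"
  by (auto simp: bilinear_product_def linear_on_def lmul_def rmul_def product_pair_apply(1,2)
      product_pair_linear[where m = RH] product_pair_linear[where m = LH])

lemma invariant_form_double: "invariant_form ds D RH LH om"
proof
  show "fd_vector_space ds D" by (rule fd_double)
  show "bilinear_product ds D RH" "bilinear_product ds D LH" by (rule bilinear_double)+
  fix u v w c
  show "om u (v + w) = om u v + om u w" if "u \<in> D" "v \<in> D" "w \<in> D"
    using that by (cases u, cases v, cases w) (auto simp: B_apply)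
  show "om u (ds c v) = c * om u v" if "u \<in> D" "v \<in> D"
    using that by (cases u, cases v) (auto simp: B_apply fscale_def algebra_simps)
  show "om u v = - om v u" by (cases u, cases v) simp
  show "om (LH u v) w = - om (RH v w) u" if "u \<in> D" "v \<in> D" "w \<in> D"
    using that by (cases u, cases v, cases w) (simp add: om_def product_pair_apply)
  show "om (RH u v) w + om (RH v w) u + om (RH w u) v = 0" if "u \<in> D" "v \<in> D" "w \<in> D"
    using that by (cases u, cases v, cases w) (simp add: om_def product_pair_apply)
next
  fix u assume u: "u \<in> D" and 0: "\<And>v. v \<in> D \<Longrightarrow> om u v = 0"
  obtain x a where [simp]: "u = (x, a)" by (cases u)
  have "a y = 0" if "y \<in> A" for y using 0[of "(y, 0)"] that by simp
  moreover have "b x = 0" if "b \<in> B" for b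
    using 0[of "(0, b)"] u that by (simp add: B_apply)
  ultimately show "u = 0"
    using D_eqI[of x 0 a 0] u by (simp add: B_apply zero_prod_def)
next
  fix \<phi> assume \<phi>: "\<phi> \<in> dual ds D"
  have lin: "\<phi> (u + v) = \<phi> u + \<phi> v" "\<phi> (ds c u) = c * \<phi> u" if "u \<in> D" "v \<in> D" for u v c
    using \<phi> that by (auto simp: dual_def linear_on_def)
  \<comment> \<open>The covector part is the restriction of \<open>\<phi>\<close> to
    \<open>A\<close>. The vector part represents the negative of its restriction to
    \<open>B\<close>, since \<open>om (x, a) (0, b) = - b x\<close>.\<close>
  let ?a = "ext0 A (\<lambda>y. \<phi> (y, 0))"
  have a: "?a \<in> B"
    using lin[of "(_, 0)" "(_, 0)"] by (simp add: dual_def[of s A] linear_on_def ext0_def)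
  have "linear_on fscale (*) B (\<lambda>b. - \<phi> (0, b))"
    using lin[of "(0, _)" "(0, _)"] by (simp add: linear_on_def)
  then obtain x where x: "x \<in> A" "\<And>b. b \<in> B \<Longrightarrow> b x = - \<phi> (0, b)"
    using bidual by blast
  have eq: "\<phi> (y, b) = ext0 D (om (x, ?a)) (y, b)" for y b
  proof (cases "(y, b) \<in> D")
    case True
    then show ?thesis using lin(1)[of "(y, 0)" "(0, b)"] x(1) x(2)[of b] by (simp add: ext0_def)
  next
    case False
    then show ?thesis using \<phi> by (simp add: dual_def[of ds D] ext0_def del: D_iff)
  qed
  show "\<exists>u\<in>D. \<phi> = ext0 D (om u)"
  proof
    show "(x, ?a) \<in> D" using a x(1) by simp
    show "\<phi> = ext0 D (om (x, ?a))" by (rule ext) (metis eq surj_pair)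
  qed
qed

interpretation dbl: invariant_form ds D RH LH om by (rule invariant_form_double)

section \<open>The dialgebra axioms of the double\<close>

lemma covector_product_apply:
  assumes "y \<in> A" "z \<in> A"
  shows "cR m x a (rh y z) = a (m (rh y z) x)" "cR m x a (lh y z) = a (m (lh y z) x)"
    "cL m x a (rh y z) = a (m x (rh y z))" "cL m x a (lh y z) = a (m x (lh y z))"
  using assms by (simp_all add: covector_apply)

lemmas double_eval = star_def RH_eq LH_eq B_apply covector_product_apply A_assoc B_assoc

text \<open>The six equations are the six ways to place two elements of \<open>A\<close> and two of
  \<open>B\<close> in four slots; other orders of the elements arise by renaming.\<close>

lemma star_star_mixed:
  assumes xyab: "x \<in> A" "y \<in> A" "a \<in> B" "b \<in> B"
  shows "om (dbl.st (x, 0) (y, 0)) (dbl.st (0, a) (0, b)) = 0"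
    "om (dbl.st (x, 0) (0, a)) (dbl.st (y, 0) (0, b)) = 0"
    "om (dbl.st (x, 0) (0, a)) (dbl.st (0, b) (y, 0)) = 0"
    "om (dbl.st (0, a) (x, 0)) (dbl.st (y, 0) (0, b)) = 0"
    "om (dbl.st (0, a) (x, 0)) (dbl.st (0, b) (y, 0)) = 0"
    "om (dbl.st (0, a) (0, b)) (dbl.st (x, 0) (y, 0)) = 0"
proof -
  \<comment> \<open>In the combination (4) - (5) - (6) + (7) of the conditions in
    \<open>compat\<close>, everything cancels except the two terms equated by (1).\<close>
  show "om (dbl.st (x, 0) (y, 0)) (dbl.st (0, a) (0, b)) = 0"
    using xyab compat(1,4,5,6,7)[of x y a b]
    by (simp add: double_eval; algebra)
  show "om (dbl.st (x, 0) (0, a)) (dbl.st (y, 0) (0, b)) = 0"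
    using xyab compat(3)[of x y a b]
    by (simp add: double_eval; algebra)
  show "om (dbl.st (x, 0) (0, a)) (dbl.st (0, b) (y, 0)) = 0"
    using xyab compat(1)[of y x a b]
    by (simp add: double_eval; algebra)
  show "om (dbl.st (0, a) (x, 0)) (dbl.st (y, 0) (0, b)) = 0"
    using xyab compat(1)[of x y b a]
    by (simp add: double_eval; algebra)
  show "om (dbl.st (0, a) (x, 0)) (dbl.st (0, b) (y, 0)) = 0"
    using xyab compat(2)[of x y a b]
    by (simp add: double_eval; algebra)
  show "om (dbl.st (0, a) (0, b)) (dbl.st (x, 0) (y, 0)) = 0"
    using xyab compat(1,4,5,6,7)[of x y a b]
    by (simp add: double_eval; algebra)
qed

text \<open>Here and in the next lemma, a distribution in which the two elements of \<open>A\<close>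
  are multiplied with each other uses the formulas for coproducts of products,
  \<open>compat(4)\<close> to \<open>compat(7)\<close>. The two distributions with only mixed
  products use \<open>compat(8)\<close> or \<open>compat(9)\<close>.\<close>

lemma rh_star_mixed:
  assumes xyab: "x \<in> A" "y \<in> A" "a \<in> B" "b \<in> B"
  shows "om (RH (x, 0) (y, 0)) (dbl.st (0, a) (0, b)) = om (RH (y, 0) (0, a)) (LH (0, b) (x, 0))"
    "om (RH (x, 0) (0, a)) (dbl.st (y, 0) (0, b)) = om (RH (0, a) (y, 0)) (LH (0, b) (x, 0))"
    "om (RH (x, 0) (0, a)) (dbl.st (0, b) (y, 0)) = om (RH (0, a) (0, b)) (LH (y, 0) (x, 0))"
    "om (RH (0, a) (x, 0)) (dbl.st (y, 0) (0, b)) = om (RH (x, 0) (y, 0)) (LH (0, b) (0, a))"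
    "om (RH (0, a) (x, 0)) (dbl.st (0, b) (y, 0)) = om (RH (x, 0) (0, b)) (LH (y, 0) (0, a))"
    "om (RH (0, a) (0, b)) (dbl.st (x, 0) (y, 0)) = om (RH (0, b) (x, 0)) (LH (y, 0) (0, a))"
proof -
  show "om (RH (x, 0) (y, 0)) (dbl.st (0, a) (0, b)) = om (RH (y, 0) (0, a)) (LH (0, b) (x, 0))"
    using xyab compat(1,4,6)[of x y a b]
    by (simp add: double_eval; algebra)
  show "om (RH (x, 0) (0, a)) (dbl.st (y, 0) (0, b)) = om (RH (0, a) (y, 0)) (LH (0, b) (x, 0))"
    using xyab compat(9)[of x y a b]
    by (simp add: double_eval; algebra)
  show "om (RH (x, 0) (0, a)) (dbl.st (0, b) (y, 0)) = om (RH (0, a) (0, b)) (LH (y, 0) (x, 0))"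
    using xyab compat(5)[of y x a b]
    by (simp add: double_eval; algebra)
  show "om (RH (0, a) (x, 0)) (dbl.st (y, 0) (0, b)) = om (RH (x, 0) (y, 0)) (LH (0, b) (0, a))"
    using xyab compat(6)[of x y b a]
    by (simp add: double_eval; algebra)
  show "om (RH (0, a) (x, 0)) (dbl.st (0, b) (y, 0)) = om (RH (x, 0) (0, b)) (LH (y, 0) (0, a))"
    using xyab compat(8)[of x y a b]
    by (simp add: double_eval; algebra)
  show "om (RH (0, a) (0, b)) (dbl.st (x, 0) (y, 0)) = om (RH (0, b) (x, 0)) (LH (y, 0) (0, a))"
    using xyab compat(1,4,5)[of x y a b]
    by (simp add: double_eval; algebra)
qed

text \<open>The two distributions with only mixed products combine \<open>compat(8)\<close> and
  \<open>compat(9)\<close> at suitably exchanged arguments, corrected by \<open>compat(2)\<close> or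
  \<open>compat(3)\<close>.\<close>

lemma rh_rh_mixed:
  assumes xyab: "x \<in> A" "y \<in> A" "a \<in> B" "b \<in> B"
  shows "om (RH (x, 0) (y, 0)) (RH (0, a) (0, b)) = om (LH (y, 0) (0, a)) (LH (0, b) (x, 0))"
    "om (RH (x, 0) (0, a)) (RH (y, 0) (0, b)) = om (LH (0, a) (y, 0)) (LH (0, b) (x, 0))"
    "om (RH (x, 0) (0, a)) (RH (0, b) (y, 0)) = om (LH (0, a) (0, b)) (LH (y, 0) (x, 0))"
    "om (RH (0, a) (x, 0)) (RH (y, 0) (0, b)) = om (LH (x, 0) (y, 0)) (LH (0, b) (0, a))"
    "om (RH (0, a) (x, 0)) (RH (0, b) (y, 0)) = om (LH (x, 0) (0, b)) (LH (y, 0) (0, a))"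
    "om (RH (0, a) (0, b)) (RH (x, 0) (y, 0)) = om (LH (0, b) (x, 0)) (LH (y, 0) (0, a))"
proof -
  show "om (RH (x, 0) (y, 0)) (RH (0, a) (0, b)) = om (LH (y, 0) (0, a)) (LH (0, b) (x, 0))"
    using xyab compat(4)[of x y a b]
    by (simp add: double_eval; algebra)
  show "om (RH (x, 0) (0, a)) (RH (y, 0) (0, b)) = om (LH (0, a) (y, 0)) (LH (0, b) (x, 0))"
    using xyab compat(9)[of x y a b] compat(2,8)[of x y b a]
    by (simp add: double_eval; algebra)
  show "om (RH (x, 0) (0, a)) (RH (0, b) (y, 0)) = om (LH (0, a) (0, b)) (LH (y, 0) (x, 0))"
    using xyab compat(7)[of y x a b]
    by (simp add: double_eval; algebra)
  show "om (RH (0, a) (x, 0)) (RH (y, 0) (0, b)) = om (LH (x, 0) (y, 0)) (LH (0, b) (0, a))"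
    using xyab compat(7)[of x y b a]
    by (simp add: double_eval; algebra)
  show "om (RH (0, a) (x, 0)) (RH (0, b) (y, 0)) = om (LH (x, 0) (0, b)) (LH (y, 0) (0, a))"
    using xyab compat(8)[of x y a b] compat(3)[of x y b a] compat(9)[of y x a b]
    by (simp add: double_eval; algebra)
  show "om (RH (0, a) (0, b)) (RH (x, 0) (y, 0)) = om (LH (0, b) (x, 0)) (LH (y, 0) (0, a))"
    using xyab compat(4)[of x y a b]
    by (simp add: double_eval; algebra)
qed

lemma dialgebra_double: "dialgebra ds D RH LH"
proof (rule dbl.dialgebraI_generators)
  let ?G = "(\<lambda>x. (x, 0)) ` A \<union> (\<lambda>a. (0, a)) ` B"
  show "?G \<subseteq> D" by auto
  show "\<exists>p\<in>?G. \<exists>q\<in>?G. u = p + q" if "u \<in> D" for u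
  proof -
    obtain x a where u: "u = (x, a)" by (cases u)
    show ?thesis
    proof (intro bexI)
      show "u = (x, 0) + (0, a)" using u by simp
    qed (use that u in auto)
  qed
  fix u v w t assume "u \<in> ?G" "v \<in> ?G" "w \<in> ?G" "t \<in> ?G"
  moreover have "(\<exists>x\<in>A. p = (x, 0)) \<or> (\<exists>a\<in>B. p = (0, a))" if "p \<in> ?G" for p
    using that by blast
  ultimately have G: "(\<exists>x\<in>A. u = (x, 0)) \<or> (\<exists>a\<in>B. u = (0, a))"
    "(\<exists>x\<in>A. v = (x, 0)) \<or> (\<exists>a\<in>B. v = (0, a))"
    "(\<exists>x\<in>A. w = (x, 0)) \<or> (\<exists>a\<in>B. w = (0, a))"
    "(\<exists>x\<in>A. t = (x, 0)) \<or> (\<exists>a\<in>B. t = (0, a))"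
    by blast+
  \<comment> \<open>Of the sixteen distributions, the six balanced ones are the mixed lemmas. The
    others hold by isotropy or by associativity in \<open>A\<close> or \<open>B\<close>, which
    simplification applies.\<close>
  show "om (dbl.st u v) (dbl.st w t) = 0"
    using G by (elim disjE bexE, simp_all only:)
      ((rule star_star_mixed; assumption) | (simp add: double_eval; fail))+
  show "om (RH u v) (dbl.st w t) = om (RH v w) (LH t u)"
    using G by (elim disjE bexE, simp_all only:)
      ((rule rh_star_mixed; assumption) | (simp add: double_eval; fail))+
  show "om (RH u v) (RH w t) = om (LH v w) (LH t u)"
    using G by (elim disjE bexE, simp_all only:)
      ((rule rh_rh_mixed; assumption) | (simp add: double_eval; fail))+
qed

lemma splitting_double:
  assumes h: "bij_betw h {..<n} I"
  shows "lagrangian_splitting ds D RH LH om (\<lambda>(x, a). (x, 0)) n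
    (\<lambda>i. (e (h i), 0)) (\<lambda>i. (0, e' (h i)))"
proof (intro lagrangian_splitting.intro invariant_form_double lagrangian_splitting_axioms.intro)
  show "dialgebra ds D RH LH" by (rule dialgebra_double)
  show "linear_on ds ds D (\<lambda>(x, a). (x, 0))" by (auto simp: linear_on_def)
next
  fix u v assume uv: "u \<in> D" "v \<in> D"
  obtain x a y b where p: "u = (x, a)" "v = (y, b)" by (cases u, cases v)
  with uv have m: "x \<in> A" "a \<in> B" "y \<in> A" "b \<in> B" by simp_all
  let ?P = "\<lambda>(x, a). (x, 0)"
  show "?P u \<in> D" using m p by simp
  show "om (?P u) (?P v) = 0" "om (u - ?P u) (v - ?P v) = 0"
    using m p by (simp_all add: B_apply)
  show "?P (RH (?P u) (?P v)) = RH (?P u) (?P v)" "?P (LH (?P u) (?P v)) = LH (?P u) (?P v)"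
    "?P (RH (u - ?P u) (v - ?P v)) = 0" "?P (LH (u - ?P u) (v - ?P v)) = 0"
    using m p by (simp_all add: RH_eq LH_eq zero_prod_def)
  \<comment> \<open>Only the covector of \<open>u\<close> and the vector of \<open>v\<close> survive
    in the factors, and expanding that covector in the dual basis gives
    \<open>- a y\<close>.\<close>
  have "(\<Sum>i<n. om u (e (h i), 0) * om v (0, e' (h i))) = (\<Sum>j\<in>I. om u (e j, 0) * om v (0, e' j))"
    by (rule sum.reindex_bij_betw[OF h])
  also have "\<dots> = - (\<Sum>j\<in>I. fscale (a (e j)) (e' j)) y"
    using m p by (simp add: B_apply sum_apply fscale_def sum_negf)
  also have "\<dots> = om (?P v) u"
    using p dual_expand_B[OF m(2)] by simp
  finally show "(\<Sum>i<n. om u (e (h i), 0) * om v (0, e' (h i))) = om (?P v) u" .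
next
  fix i assume "i < n"
  then have "h i \<in> I" using h by (auto simp: bij_betw_def)
  then show "(e (h i), 0) \<in> D" "(0, e' (h i)) \<in> D"
    using e_in_A dual_basis(1) by simp_all
qed

text \<open>A decomposition in \<open>daybe\<close> is numbered by \<open>i < n\<close>, so the sum
  over \<open>I\<close> is transported along \<open>h\<close>.\<close>

lemma factorizable_double:
  assumes h: "bij_betw h {..<n::nat} I"
  shows "factorizable ds D RH LH (\<Sum>i\<in>I. tens ds D (e i, 0) (0, e' i))"
  using lagrangian_splitting.factorizable_r[OF splitting_double[OF h]]
    sum.reindex_bij_betw[OF h, of "\<lambda>i. tens ds D (e i, 0) (0, e' i)"] by simp

end

theorem theorem4p19:
  fixes s :: "'f::field_char_0 \<Rightarrow> 'a::ab_group_add \<Rightarrow> 'a"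
    and A :: "'a set"
    and rh lh :: "'a \<Rightarrow> 'a \<Rightarrow> 'a"
    and dr dl :: "'a \<Rightarrow> ('a, 'f) tensor2"
    and n :: nat
    and e :: "nat \<Rightarrow> 'a"
    and e' :: "nat \<Rightarrow> 'a \<Rightarrow> 'f"
  assumes "bi_dialgebra s A rh lh dr dl"
    and basis: "inj_on e {1..n}" "module.independent s (e ` {1..n})" "module.span s (e ` {1..n}) = A"
    and dual_basis: "\<And>i. i \<in> {1..n} \<Longrightarrow> e' i \<in> dual s A"
      "\<And>i j. i \<in> {1..n} \<Longrightarrow> j \<in> {1..n} \<Longrightarrow> e' i (e j) = (if i = j then 1 else 0)"
  shows "factorizable (double_scale s) (double_carrier s A)
           (double_rh s A rh lh dr dl) (double_lh s A rh lh dr dl)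
           (\<Sum>i=1..n. tens (double_scale s) (double_carrier s A) (e i, 0) (0, e' i))"
proof -
  interpret based_bi_dialgebra s A rh lh dr dl "{1..n}" e e'
    by unfold_locales (use assms in auto)
  \<comment> \<open>The basis is numbered from 1 and the decomposition of \<open>r\<close> from 0;
    \<open>Suc\<close> is the shift between them.\<close>
  have "bij_betw Suc {..<n} {1..n}"
    by (auto simp: bij_betw_def image_Suc_lessThan)
  then show ?thesis by (rule factorizable_double)
qed

end
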